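(* Let $\Gamma$ be a connected $3$-valent girth-regular graph of girth $2d+1$ for some integer $d$ and signature $(a_1,a_2,a_3)$ with $a_3=2^d$. Then $\Gamma$ is isomorphic to $K_4$ or to the Petersen graph.
   Context: Graphs are finite and simple. For a graph $\Gamma$ of finite girth $g$, a girth cycle is a cycle of length $g$, and for an edge $e$, $\epsilon(e)$ denotes the number of girth cycles containing $e$. If $v$ is a vertex with incident edges $e_1,\ldots,e_k$ ordered so that $\epsilon(e_1)\le\cdots\le\epsilon(e_k)$, the signature of $v$ is $(\epsilon(e_1),\ldots,\epsilon(e_k))$. A graph is girth-regular if all its vertices have the same signature, called the signature of the graph. *)

theory Defs
  imports "Graph_Theory.Graph_Theory" "HOL-Library.Extended_Nat" "HOL-Library.Multiset"
begin

text \<open>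
  Finite simple graphs are modelled, as in the locale \<^locale>\<open>graph\<close>, by finite symmetric
  digraphs without loops and parallel arcs; an undirected edge is the set of the two ends of a
  pair of opposite arcs.
\<close>

definition edge_of :: "('a,'b) pre_digraph \<Rightarrow> 'b \<Rightarrow> 'a set" where
  "edge_of G a = {tail G a, head G a}"

definition incident_edges :: "('a,'b) pre_digraph \<Rightarrow> 'a \<Rightarrow> 'a set set" where
  "incident_edges G v = {e \<in> edge_of G ` arcs G. v \<in> e}"

text \<open>
  In a symmetric digraph an arc followed by its opposite is a closed walk satisfying
  \<^const>\<open>pre_digraph.cycle\<close>; the length condition excludes exactly these.
\<close>

definition undirected_cycle :: "('a,'b) pre_digraph \<Rightarrow> 'b list \<Rightarrow> bool" where
  "undirected_cycle G p \<longleftrightarrow> pre_digraph.cycle G p \<and> 3 \<le> length p"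

definition girth :: "('a,'b) pre_digraph \<Rightarrow> enat" where
  "girth G = (INF p \<in> {p. undirected_cycle G p}. enat (length p))"

text \<open>
  Cycles are counted as subgraphs, irrespective of starting point and orientation, hence
  represented by their edge sets.
\<close>

definition girth_cycles :: "('a,'b) pre_digraph \<Rightarrow> 'a set set set" where
  "girth_cycles G = {edge_of G ` set p | p. undirected_cycle G p \<and> enat (length p) = girth G}"

definition girth_cycle_count :: "('a,'b) pre_digraph \<Rightarrow> 'a set \<Rightarrow> nat" where
  "girth_cycle_count G e = card {C \<in> girth_cycles G. e \<in> C}"

definition vertex_signature :: "('a,'b) pre_digraph \<Rightarrow> 'a \<Rightarrow> nat list" where
  "vertex_signature G v =
     sorted_list_of_multiset (image_mset (girth_cycle_count G) (mset_set (incident_edges G v)))"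

definition has_signature :: "('a,'b) pre_digraph \<Rightarrow> nat list \<Rightarrow> bool" where
  "has_signature G s \<longleftrightarrow> (\<forall>v \<in> verts G. vertex_signature G v = s)"

definition girth_regular :: "('a,'b) pre_digraph \<Rightarrow> bool" where
  "girth_regular G \<longleftrightarrow> girth G \<noteq> \<infinity> \<and> (\<exists>s. has_signature G s)"

definition complete_graph :: "nat \<Rightarrow> nat pair_pre_digraph" where
  "complete_graph n = \<lparr> pverts = {0..<n}, parcs = {(u, v). u < n \<and> v < n \<and> u \<noteq> v} \<rparr>"

text \<open>The Petersen graph as the Kneser graph on the 2-subsets of a 5-set.\<close>

definition petersen_graph :: "nat set pair_pre_digraph" where
  "petersen_graph =
     (let V = {A. A \<subseteq> {0..<5} \<and> card A = 2}
      in \<lparr> pverts = V, parcs = {(A, B). A \<in> V \<and> B \<in> V \<and> A \<inter> B = {}} \<rparr>)"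

lemma complete_digraph_complete_graph: "complete_digraph n (with_proj (complete_graph n))"
proof -
  have "finite {(u, v). u < n \<and> v < n \<and> u \<noteq> v}"
    by (rule finite_subset[of _ "{0..<n} \<times> {0..<n}"]) auto
  then have "graph (with_proj (complete_graph n))"
    by unfold_locales
      (auto simp: complete_graph_def arc_to_ends_def symmetric_def intro!: symI)
  then show ?thesis
    by (auto simp: complete_digraph_def complete_graph_def)
qed

lemma graph_petersen_graph: "graph (with_proj petersen_graph)"
proof -
  let ?V = "{A :: nat set. A \<subseteq> {0..<5} \<and> card A = 2}"
  have V: "finite ?V"
    by (rule finite_subset[of _ "Pow {0..<5}"]) auto
  have "finite {(A, B). A \<in> ?V \<and> B \<in> ?V \<and> A \<inter> B = {}}"
    by (rule finite_subset[of _ "?V \<times> ?V"]) (use V in auto)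
  with V show ?thesis
    by unfold_locales
      (auto simp: petersen_graph_def Let_def arc_to_ends_def symmetric_def intro!: symI)
qed

end

theory Submission
  imports Defs "Jordan_Normal_Form.Schur_Decomposition"
    "HOL-Computational_Algebra.Polynomial_Factorial"
begin

text \<open>
  An edge \<open>uv\<close> lies on at most \<open>2 ^ d\<close> girth cycles, and on exactly \<open>2 ^ d\<close> of them only if the
  balls of radius \<open>d\<close> around \<open>u\<close> and \<open>v\<close> coincide. If every vertex is on such an edge, then a
  ball of radius \<open>d\<close> has no edge to its complement, so the graph is a cubic Moore graph of
  diameter \<open>d\<close>.

  Let \<open>G\<^sub>i\<close> be the polynomial that expresses the relation ``distance at most \<open>i\<close>'' by the
  adjacency matrix, so that \<open>G\<^sub>d\<close> yields the all-ones matrix. The eigenvalues other than 3 are the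
  roots of \<open>G\<^sub>d\<close>, and the traces of \<open>G\<^sub>0, \<dots>, G\<^sub>d\<close>, all equal to the number \<open>n\<close> of vertices,
  determine the multiplicity \<open>m\<close> of a root \<open>\<lambda>\<close>:
  \<open>m (3 - \<lambda>) ((2 d + 1) \<lambda> + 6 d + 4) = 3 n (8 - \<lambda>\<^sup>2)\<close>. Hence \<open>\<lambda>\<close> has degree at most 2 over the
  rationals. All roots have modulus less than \<open>2 \<surd>2\<close>, which for \<open>d \<ge> 6\<close> leaves only the
  integers from -2 to 2, too few for the \<open>d\<close> distinct roots of \<open>G\<^sub>d\<close>; the cases 3, 4, 5 are
  excluded by inspection. Diameter 1 gives the complete graph and diameter 2 the Petersen graph.
\<close>

section \<open>Walks and balls in graphs of large girth\<close>

text \<open>Non-backtracking walks, listed by their vertices: no edge is followed by its reverse.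
  The empty list is excluded, so \<open>hd\<close> and \<open>last\<close> are the ends of the walk;
  a walk with \<open>k\<close> edges has length \<open>k + 1\<close>.\<close>

fun nb_walk :: "('a \<Rightarrow> 'a \<Rightarrow> bool) \<Rightarrow> 'a list \<Rightarrow> bool" where
  "nb_walk A [] \<longleftrightarrow> False"
| "nb_walk A [x] \<longleftrightarrow> True"
| "nb_walk A [x, y] \<longleftrightarrow> A x y"
| "nb_walk A (x # y # z # zs) \<longleftrightarrow> A x y \<and> x \<noteq> z \<and> nb_walk A (y # z # zs)"

text \<open>The starting vertex is listed only once, so \<open>length xs\<close> is the length of
  the cycle.\<close>

definition vertex_cycle :: "('a \<Rightarrow> 'a \<Rightarrow> bool) \<Rightarrow> 'a list \<Rightarrow> bool" where
  "vertex_cycle A xs \<longleftrightarrow> 3 \<le> length xs \<and> distinct xs \<and> successively A xs \<and> A (last xs) (hd xs)"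

fun path_edges :: "'a list \<Rightarrow> 'a set set" where
  "path_edges (x # y # zs) = insert {x, y} (path_edges (y # zs))"
| "path_edges _ = {}"

text \<open>\<open>reach A i x\<close> is the ball of radius \<open>i\<close> around
  \<open>x\<close> as a predicate; balls coincide exactly if these predicates are equal.\<close>

fun reach :: "('a \<Rightarrow> 'a \<Rightarrow> bool) \<Rightarrow> nat \<Rightarrow> 'a \<Rightarrow> 'a \<Rightarrow> bool" where
  "reach A 0 x y \<longleftrightarrow> x = y"
| "reach A (Suc i) x y \<longleftrightarrow> reach A i x y \<or> (\<exists>z. A x z \<and> reach A i z y)"

lemma nb_walk_Cons_iff:
  "nb_walk A (x # y # zs) \<longleftrightarrow> A x y \<and> (zs \<noteq> [] \<longrightarrow> hd zs \<noteq> x) \<and> nb_walk A (y # zs)"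
  by (cases zs) auto

lemma nb_walk_append2: "nb_walk A (xs @ ys) \<Longrightarrow> ys \<noteq> [] \<Longrightarrow> nb_walk A ys"
proof (induction xs)
  case (Cons x xs)
  then show ?case by (cases "xs @ ys") (auto simp: nb_walk_Cons_iff)
qed simp

lemma nb_walk_append1: "nb_walk A (xs @ ys) \<Longrightarrow> xs \<noteq> [] \<Longrightarrow> nb_walk A xs"
proof (induction xs)
  case (Cons x xs)
  then show ?case by (cases xs) (auto simp: nb_walk_Cons_iff)
qed simp

lemma nb_walk_join:
  assumes "nb_walk A (xs @ [x])" "nb_walk A (x # ys)" "xs = [] \<or> ys = [] \<or> last xs \<noteq> hd ys"
  shows "nb_walk A (xs @ x # ys)"
  using assms
proof (induction xs)
  case (Cons a xs)
  show ?case
  proof (cases xs)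
    case Nil
    with Cons.prems show ?thesis by (auto simp: nb_walk_Cons_iff)
  next
    case (Cons b xs')
    have "nb_walk A (xs @ [x])" using Cons.prems Cons by (auto simp: nb_walk_Cons_iff)
    with Cons.IH Cons.prems Cons have "nb_walk A (xs @ x # ys)" by auto
    with Cons.prems Cons show ?thesis
      by (cases xs') (auto simp: nb_walk_Cons_iff)
  qed
qed simp

lemma nb_walk_successively: "nb_walk A xs \<Longrightarrow> successively A xs"
  by (induction A xs rule: nb_walk.induct) auto

lemma distinct_successively_nb_walk:
  "xs \<noteq> [] \<Longrightarrow> distinct xs \<Longrightarrow> successively A xs \<Longrightarrow> nb_walk A xs"
  by (induction A xs rule: nb_walk.induct) auto

lemma path_edges_append:
  "path_edges (xs @ y # ys) = path_edges (xs @ [y]) \<union> path_edges (y # ys)"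
proof (induction xs)
  case (Cons x xs)
  then show ?case by (cases xs) auto
qed simp

lemma path_edges_rev: "path_edges (rev xs) = path_edges xs"
proof (induction xs rule: path_edges.induct)
  case (1 x y zs)
  have "path_edges (rev (x # y # zs)) = path_edges (rev zs @ y # [x])" by simp
  also have "\<dots> = path_edges (rev (y # zs)) \<union> {{y, x}}"
    by (subst path_edges_append) simp
  finally show ?case using 1 by auto
qed auto

lemma reach_refl [simp]: "reach A i x x"
  by (induction i) auto

lemma reach_mono: "reach A i x y \<Longrightarrow> i \<le> j \<Longrightarrow> reach A j x y"
  by (induction j) (auto simp: le_Suc_eq)

lemma reach_step: "A x z \<Longrightarrow> reach A i z y \<Longrightarrow> reach A (Suc i) x y"
  by auto

lemma reach_step': "reach A i x z \<Longrightarrow> A z y \<Longrightarrow> reach A (Suc i) x y"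
  by (induction i arbitrary: x) auto

lemma reach_SucE:
  assumes "reach A (Suc i) x y"
  obtains "x = y" | z where "A x z" "reach A i z y"
proof -
  have "x = y \<or> (\<exists>z. A x z \<and> reach A i z y)"
    using assms
  proof (induction i)
    case (Suc i)
    then show ?case by (metis reach.simps(2))
  qed auto
  thus ?thesis using that by blast
qed

lemma nb_walk_reach: "nb_walk A xs \<Longrightarrow> length xs \<le> Suc i \<Longrightarrow> reach A i (hd xs) (last xs)"
proof (induction xs arbitrary: i)
  case (Cons x xs)
  show ?case
  proof (cases xs)
    case (Cons y ys)
    with Cons.prems obtain j where "i = Suc j" by (cases i) auto
    with Cons Cons.prems Cons.IH[of j] show ?thesis by (auto simp: nb_walk_Cons_iff)
  qed simp
qed simp

text \<open>A step put in front of a non-backtracking walk either leaves it non-backtracking or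
  cancels against its first step; in the second case both steps are dropped.\<close>

lemma reach_nb_walk:
  "reach A i x y \<Longrightarrow> \<exists>xs. nb_walk A (x # xs) \<and> last (x # xs) = y \<and> length xs \<le> i"
proof (induction i arbitrary: x)
  case 0
  then show ?case by (intro exI[of _ "[]"]) auto
next
  case (Suc i)
  from Suc.prems consider "reach A i x y" | z where "A x z" "reach A i z y" by auto
  thus ?case
  proof cases
    case 1
    with Suc.IH show ?thesis using le_SucI by blast
  next
    case 2
    then obtain zs where zs: "nb_walk A (z # zs)" "last (z # zs) = y" "length zs \<le> i"
      using Suc.IH by blast
    show ?thesis
    proof (cases "zs \<noteq> [] \<and> hd zs = x")
      case True
      then obtain ys where "zs = x # ys" by (cases zs) auto
      with zs show ?thesis by (intro exI[of _ ys]) (auto simp: nb_walk_Cons_iff)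
    next
      case False
      with zs 2 show ?thesis by (intro exI[of _ "z # zs"]) (auto simp: nb_walk_Cons_iff)
    qed
  qed
qed

locale simple_graph =
  fixes A :: "'a \<Rightarrow> 'a \<Rightarrow> bool"
  assumes sym: "A x y \<Longrightarrow> A y x" and irrefl: "\<not> A x x"
begin

lemma reach_sym: "reach A i x y \<longleftrightarrow> reach A i y x"
proof -
  have "reach A i x y \<Longrightarrow> reach A i y x" for x y
  proof (induction i arbitrary: x)
    case (Suc i)
    then show ?case using reach_step'[of A i y _ x] sym by auto
  qed auto
  thus ?thesis by blast
qed

lemma nb_walk_rev: "nb_walk A xs \<Longrightarrow> nb_walk A (rev xs)"
proof (induction xs)
  case (Cons x xs)
  consider "xs = []" | y where "xs = [y]" | y z zs where "xs = y # z # zs"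
    by (metis list.exhaust)
  thus ?case
  proof cases
    case 2
    thus ?thesis using Cons.prems by (simp add: sym)
  next
    case 3
    have "A y x" using Cons.prems by (simp add: 3 sym)
    hence "nb_walk A [y, x]" by simp
    hence "nb_walk A ((rev zs @ [z]) @ y # [x])"
      by (rule nb_walk_join[rotated]) (use Cons 3 in auto)
    thus ?thesis by (simp add: 3)
  qed simp
qed simp

text \<open>Drop the first vertex. If the rest is distinct, it is the cycle; otherwise the stretch
  between two occurrences of a vertex is a shorter closed walk. Lengths 1 and 2 cannot occur, for
  want of loops and of backtracking.\<close>

lemma closed_nb_walk_cycle:
  assumes "nb_walk A xs" "2 \<le> length xs" "hd xs = last xs"
  shows "\<exists>ys. vertex_cycle A ys \<and> length ys < length xs"
  using assms
proof (induction "length xs" arbitrary: xs rule: less_induct)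
  case less
  obtain x ys where xs: "xs = x # ys" "ys \<noteq> []" using less.prems(2) by (cases xs; cases "tl xs") auto
  hence last: "last ys = x" using less.prems by simp
  show ?case
  proof (cases "distinct ys")
    case True
    have "3 \<le> length ys"
    proof (rule ccontr)
      assume "\<not> 3 \<le> length ys"
      with xs consider y where "ys = [y]" | y z where "ys = [y, z]"
        by (cases ys; cases "tl ys"; cases "tl (tl ys)") auto
      thus False using last less.prems xs irrefl by cases auto
    qed
    moreover have "A (last ys) (hd ys)" "successively A ys"
      using less.prems xs nb_walk_successively[of A xs] unfolding last by (cases ys; auto)+
    ultimately have "vertex_cycle A ys" using True by (auto simp: vertex_cycle_def)
    thus ?thesis using xs by auto
  next
    case False
    then obtain as bs cs y where ys: "ys = as @ [y] @ bs @ [y] @ cs"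
      using not_distinct_decomp by blast
    have "nb_walk A ((x # as) @ (y # bs @ [y]) @ cs)" using less.prems(1) xs ys by simp
    hence "nb_walk A (y # bs @ [y])" using nb_walk_append1 nb_walk_append2 by blast
    from less.hyps[OF _ this] show ?thesis using xs ys by fastforce
  qed
qed

end

text \<open>The ends of the non-backtracking walks that begin with \<open>v\<close>,
  \<open>u\<close> and continue for \<open>k\<close> more steps.\<close>

fun branch :: "('a \<Rightarrow> 'a \<Rightarrow> bool) \<Rightarrow> nat \<Rightarrow> 'a \<Rightarrow> 'a \<Rightarrow> 'a set" where
  "branch A 0 v u = {u}"
| "branch A (Suc k) v u = (\<Union>w \<in> {w. A u w} - {v}. branch A k u w)"

lemma nb_walk_branch:
  "nb_walk A (v # u # us) \<Longrightarrow> last (u # us) \<in> branch A (length us) v u"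
proof (induction us arbitrary: u v)
  case (Cons w us)
  have "last (w # us) \<in> branch A (length us) u w"
    using Cons by (auto simp: nb_walk_Cons_iff)
  then show ?case using Cons.prems by (auto simp: nb_walk_Cons_iff)
qed simp

section \<open>Cubic graphs of girth at least \<open>2 * d + 1\<close>\<close>

locale cubic_graph = simple_graph A for A :: "'a \<Rightarrow> 'a \<Rightarrow> bool" +
  fixes V :: "'a set" and d :: nat
  assumes finite_V: "finite V"
    and adj_V: "A x y \<Longrightarrow> x \<in> V"
    and cubic: "x \<in> V \<Longrightarrow> card {y. A x y} = 3"
    and girth_ge: "vertex_cycle A xs \<Longrightarrow> 2 * d + 1 \<le> length xs"
    and d_pos: "0 < d"
begin

lemma adj_V': "A x y \<Longrightarrow> y \<in> V"
  using adj_V sym by blast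

lemma finite_nbrs: "finite {y. A x y}"
  by (rule finite_subset[OF _ finite_V]) (auto dest: adj_V')

text \<open>Strip the common beginning. Where the walks diverge, the reverse of one glued to the
  other is a closed non-backtracking walk with at most \<open>2 * d + 1\<close> listed vertices, and
  so contains a cycle of length at most \<open>2 * d\<close>.\<close>

lemma nb_walk_unique:
  assumes "nb_walk A xs" "nb_walk A ys" "hd xs = hd ys" "last xs = last ys"
    and "length xs + length ys \<le> 2 * d + 2"
  shows "xs = ys"
  using assms
proof (induction xs arbitrary: ys)
  case (Cons x xs)
  from Cons.prems obtain ys' where ys: "ys = x # ys'" by (cases ys) auto
  have no_closed: False if "nb_walk A zs" "2 \<le> length zs" "hd zs = last zs" "length zs \<le> 2 * d + 1" for zs
    using closed_nb_walk_cycle[OF that(1-3)] girth_ge that(4) by fastforce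
  show ?case
  proof (cases "xs = [] \<or> ys' = []")
    case True
    thus ?thesis
    proof
      assume "xs = []"
      moreover have "ys' = []"
      proof (rule ccontr)
        assume "ys' \<noteq> []"
        moreover from this have "2 \<le> length ys" by (cases ys') (auto simp: ys)
        ultimately show False using no_closed[of ys] Cons.prems \<open>xs = []\<close> by simp
      qed
      ultimately show ?thesis by (simp add: ys)
    next
      assume "ys' = []"
      moreover have "xs = []"
      proof (rule ccontr)
        assume "xs \<noteq> []"
        moreover from this have "2 \<le> length (x # xs)" by (cases xs) auto
        ultimately show False using no_closed[of "x # xs"] Cons.prems \<open>ys' = []\<close> ys by simp
      qed
      ultimately show ?thesis by (simp add: ys)
    qed
  next
    case False
    then obtain a xs' b ys'' where eqs: "xs = a # xs'" "ys' = b # ys''"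
      by (cases xs; cases ys') auto
    show ?thesis
    proof (cases "a = b")
      case True
      have "xs = ys'" using Cons.prems eqs ys True
        by (intro Cons.IH) (auto simp: nb_walk_Cons_iff)
      thus ?thesis by (simp add: ys)
    next
      case False
      have "nb_walk A (rev (x # xs))" by (rule nb_walk_rev) (rule Cons.prems)
      hence "nb_walk A (rev xs @ [x])" by simp
      hence "nb_walk A (rev xs @ x # ys')"
        by (rule nb_walk_join) (use Cons.prems False eqs ys in auto)
      from no_closed[OF this] show ?thesis using Cons.prems eqs ys
        by (auto simp: hd_append last_rev hd_rev split: if_splits)
    qed
  qed
qed simp

text \<open>By uniqueness, the walks from \<open>x\<close> to \<open>y\<close> through
  \<open>z\<close> and through \<open>z'\<close> are not both non-backtracking. One of them returns
  to \<open>x\<close> after its first step, which leaves a walk of length at most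
  \<open>i - 1\<close> from \<open>x\<close>.\<close>

lemma two_nbrs_closer:
  assumes "A x z" "A x z'" "z \<noteq> z'" "reach A i z y" "reach A i z' y" "i < d"
  obtains j where "i = Suc j" "reach A j x y"
proof -
  have via: "nb_walk A (x # z # zs) \<or> (\<exists>j. i = Suc j \<and> reach A j x y)"
    if "A x z" "nb_walk A (z # zs)" "last (z # zs) = y" "length zs \<le> i" for z zs
  proof (cases "zs \<noteq> [] \<and> hd zs = x")
    case True
    then obtain ys where ys: "zs = x # ys" by (cases zs) auto
    with that(4) obtain j where "i = Suc j" by (cases i) auto
    moreover have "reach A j x y"
      using nb_walk_reach[of A "x # ys" j] that ys \<open>i = Suc j\<close> by (auto simp: nb_walk_Cons_iff)
    ultimately show ?thesis by blast
  qed (use that in \<open>auto simp: nb_walk_Cons_iff\<close>)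
  obtain zs where zs: "nb_walk A (z # zs)" "last (z # zs) = y" "length zs \<le> i"
    using reach_nb_walk[OF assms(4)] by blast
  obtain zs' where zs': "nb_walk A (z' # zs')" "last (z' # zs') = y" "length zs' \<le> i"
    using reach_nb_walk[OF assms(5)] by blast
  have "\<not> (nb_walk A (x # z # zs) \<and> nb_walk A (x # z' # zs'))"
    using nb_walk_unique[of "x # z # zs" "x # z' # zs'"] zs zs' assms by auto
  thus ?thesis using via[OF assms(1) zs] via[OF assms(2) zs'] that by blast
qed

lemma card_branch: "A v u \<Longrightarrow> card (branch A k v u) \<le> 2 ^ k \<and> finite (branch A k v u)"
proof (induction k arbitrary: v u)
  case (Suc k)
  let ?N = "{w. A u w} - {v}"
  have N: "finite ?N" "card ?N = 2"
    using finite_nbrs[of u] cubic[OF adj_V'[OF Suc.prems]] sym[OF Suc.prems]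
    by (auto simp: card_Diff_singleton)
  have "card (branch A (Suc k) v u) \<le> (\<Sum>w\<in>?N. card (branch A k u w))"
    using card_UN_le[OF N(1)] by simp
  also have "\<dots> \<le> (\<Sum>w\<in>?N. 2 ^ k)" using Suc.IH by (intro sum_mono) auto
  also have "\<dots> = 2 ^ Suc k" using N by simp
  finally show ?case using Suc.IH N(1) by auto
qed simp

text \<open>The property that an edge on \<open>2 ^ d\<close> girth cycles is shown to have; only
  this property is used to bound the diameter.\<close>

definition full :: "'a \<Rightarrow> 'a \<Rightarrow> bool" where
  "full u v \<longleftrightarrow> A u v \<and> reach A d u = reach A d v"

text \<open>
  If \<open>z\<close> were outside the ball around \<open>u\<close>, consider the neighbour \<open>a2\<close> of \<open>u\<close> that is neither
  \<open>v\<close> nor on the path to \<open>p\<close>. It has distance \<open>d\<close> from \<open>p\<close>, hence also from \<open>w\<close>, but no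
  neighbour of \<open>w\<close> can be the second vertex of a path of length \<open>d\<close> from \<open>w\<close> to \<open>a2\<close>.
\<close>

lemma full_nbr_closed:
  assumes uv: "full u v" and wz: "A w z"
    and p: "full w p" "A w p" "reach A (d - 1) p u"
    and q: "A w q" "reach A (d - 1) q v" "p \<noteq> q"
  shows "reach A d u z"
proof (rule ccontr)
  assume nz: "\<not> reach A d u z"
  obtain e where d: "d = Suc e" using d_pos by (cases d) auto
  have uvA: "A u v" and uvR: "reach A d u = reach A d v" using uv by (auto simp: full_def)
  have pu: "reach A e p u" and qv: "reach A e q v" using p q d by auto
  have nwu: "\<not> reach A e w u" using nz wz d reach_step[of A z w e u] reach_sym sym by metis
  have nwv: "\<not> reach A e w v"
    using nz wz d reach_step[of A z w e v] reach_sym sym uvR by metis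
  show False
  proof (cases e)
    case 0
    hence "p = u" using pu by simp
    moreover have "reach A d w z" using wz d by auto
    ultimately show False using nz p(1) by (auto simp: full_def)
  next
    case (Suc f)
    have nup: "\<not> reach A f u p" 
      using nwu reach_step[of A w p f u] p(2) reach_sym[of f u p] Suc by auto
    have nvp: "\<not> reach A f v p"
      using nwv reach_step[of A w p f v] p(2) reach_sym[of f v p] Suc by auto
    have nuq: "\<not> reach A f u q" 
      using nwu reach_step[of A w q f u] q(1) reach_sym[of f u q] Suc by auto
    have "reach A e u p" using pu reach_sym by blast
    then obtain a1 where a1: "A u a1" "reach A f a1 p"
      using nup Suc by auto
    have "a1 \<noteq> v" using a1 nvp by auto
    have "card ({y. A u y} - {v, a1}) = 1"
      using cubic[OF adj_V[OF uvA]] uvA a1(1) \<open>a1 \<noteq> v\<close> by (subst card_Diff_subset) auto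
    then obtain a2 where "{y. A u y} - {v, a1} = {a2}" by (auto simp: card_1_singleton_iff)
    hence a2: "A u a2" "a2 \<noteq> v" "a2 \<noteq> a1" by auto
    have closer: False if "A u b" "A u c" "b \<noteq> c" "reach A e b y" "reach A e c y" "\<not> reach A f u y" for b c y
      using two_nbrs_closer[of u b c e y] that d Suc by auto
    have "reach A d p a2" using pu a2 d reach_step' by metis
    hence "reach A d w a2" using p(1) by (auto simp: full_def)
    then consider "w = a2" | c where "A w c" "reach A e c a2"
      unfolding d by (rule reach_SucE) auto
    thus False
    proof cases
      case 1
      hence "A w u" using a2(1) sym by blast
      hence "reach A (Suc 0) w u" by auto
      from reach_mono[OF this, of e] show False using nwu Suc by simp
    next
      case 2
      have "reach A e u p" "reach A e v q" using pu qv reach_sym by blast+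
      hence "reach A d u p" "reach A d v q" unfolding d by simp_all
      hence "reach A d u p" "reach A d u q" by (simp_all only: uvR)
      hence "z \<noteq> p" "z \<noteq> q" using nz by auto
      hence "{p, q, z} = {y. A w y}"
        using cubic[OF adj_V[OF wz]] finite_nbrs[of w] p(2) q(1) q(3) wz by (intro card_seteq) auto
      \<comment> \<open>For \<open>c = p\<close> the neighbours \<open>a1\<close> and
        \<open>a2\<close> of \<open>u\<close> are both within \<open>e\<close> of \<open>p\<close>,
        for \<open>c = q\<close> the neighbours \<open>v\<close> and \<open>a2\<close> are both
        within \<open>e\<close> of \<open>q\<close>; each contradicts that \<open>u\<close> is at
        distance exactly \<open>e\<close> there. For \<open>c = z\<close> the vertex
        \<open>z\<close> would lie in the ball.\<close>
      then consider "c = p" | "c = q" | "c = z" using 2(1) by auto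
      thus False
      proof cases
        case 1
        show False
          using closer[of a1 a2 p] a1 a2 nup 2(2) 1 reach_sym[of e a2 p] reach_mono[of A f a1 p e] Suc
          by auto
      next
        case 2
        show False
          using closer[of v a2 q] uvA a2 nuq \<open>reach A e c a2\<close> 2 qv reach_sym by metis
      next
        case 3
        hence "reach A d z u" using \<open>reach A e c a2\<close> a2(1) sym d reach_step' by metis
        thus False using nz reach_sym by blast
      qed
    qed
  qed
qed

text \<open>If \<open>z\<close> is outside the ball, then \<open>w\<close> is at distance exactly
  \<open>d\<close> from both \<open>u\<close> and \<open>v\<close>. First steps \<open>p\<close> and
  \<open>q\<close> towards them are distinct, so \<open>z\<close> is the third neighbour of
  \<open>w\<close>. The full edge at \<open>w\<close> cannot lead to \<open>z\<close>, and
  \<open>full_nbr_closed\<close> excludes \<open>p\<close> and, with \<open>u\<close> and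
  \<open>v\<close> exchanged, \<open>q\<close>.\<close>

lemma ball_closed:
  assumes full: "\<And>x. x \<in> V \<Longrightarrow> \<exists>y. full x y"
    and u: "u \<in> V" and w: "reach A d u w" and wz: "A w z"
  shows "reach A d u z"
proof (rule ccontr)
  assume nz: "\<not> reach A d u z"
  obtain e where d: "d = Suc e" using d_pos by (cases d) auto
  obtain v where uv: "full u v" using full[OF u] by blast
  have uvA: "A u v" and uvR: "reach A d u = reach A d v" using uv by (auto simp: full_def)
  have vu: "full v u" using uv sym by (auto simp: full_def)
  have nwu: "\<not> reach A e w u" using nz wz d reach_step[of A z w e u] reach_sym sym by metis
  have nwv: "\<not> reach A e w v"
    using nz wz d reach_step[of A z w e v] reach_sym sym uvR by metis
  have "reach A (Suc e) w u" "reach A (Suc e) w v" using w uvR d reach_sym by metis+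
  then obtain p q where p: "A w p" "reach A e p u" and q: "A w q" "reach A e q v"
    using reach_SucE[of A e w u] reach_SucE[of A e w v] nwu nwv reach_refl by metis
  \<comment> \<open>A common first step \<open>p\<close> would be within \<open>e\<close> of
    \<open>u\<close> and \<open>v\<close> but no closer. Then \<open>u\<close> has two neighbours
    closer to \<open>p\<close> than it should, namely \<open>v\<close> and one on a path to
    \<open>p\<close>; for \<open>e = 0\<close> the vertices \<open>u\<close> and \<open>v\<close>
    would be equal.\<close>
  have "p \<noteq> q"
  proof
    assume [simp]: "p = q"
    show False
    proof (cases e)
      case 0
      thus False using p q uvA irrefl by auto
    next
      case (Suc f)
      have nup: "\<not> reach A f u p" and nvp: "\<not> reach A f v p"
        using nwu nwv reach_step[of A w p f] p(1) reach_sym Suc by metis+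
      have up: "reach A e u p" and vp: "reach A e v p" using p q reach_sym by auto
      then obtain a where a: "A u a" "reach A f a p" using nup Suc by auto
      have "a \<noteq> v" using a nvp by auto
      thus False
        using two_nbrs_closer[of u a v e p] a uvA vp nup reach_mono[of A f a p e] Suc d by auto
    qed
  qed
  have "reach A e u p" "reach A e v q" using p q reach_sym by blast+
  hence "reach A d u p" "reach A d v q" unfolding d by simp_all
  hence "reach A d u p" "reach A d u q" by (simp_all only: uvR)
  hence "z \<noteq> p" "z \<noteq> q" using nz by auto
  hence nbrs: "{p, q, z} = {y. A w y}"
    using cubic[OF adj_V[OF wz]] finite_nbrs[of w] p q wz \<open>p \<noteq> q\<close> by (intro card_seteq) auto
  obtain y where y: "full w y" using full[OF adj_V[OF wz]] by blast
  hence "A w y" by (simp add: full_def)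
  moreover have "y \<noteq> z"
    using y w nz reach_sym by (metis full_def)
  ultimately have "y = p \<or> y = q" using nbrs by auto
  thus False
  proof
    assume "y = p"
    thus False using full_nbr_closed[OF uv wz _ p(1) _ q(1) _ \<open>p \<noteq> q\<close>] y p q d nz by simp
  next
    assume "y = q"
    from full_nbr_closed[OF vu wz _ q(1) _ p(1) _ \<open>p \<noteq> q\<close>[symmetric]]
    have "reach A d v z" using y p q d \<open>y = q\<close> by simp
    thus False using nz by (simp only: uvR not_True_eq_False)
  qed
qed

lemma full_imp_diameter:
  assumes full: "\<And>x. x \<in> V \<Longrightarrow> \<exists>y. full x y"
    and u: "u \<in> V" and "reach A i u x"
  shows "reach A d u x"
proof -
  have "reach A i w x \<Longrightarrow> reach A d u w \<Longrightarrow> reach A d u x" for w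
    by (induction i arbitrary: w) (use ball_closed[OF full u] in auto)
  from this[OF assms(3) reach_refl] show ?thesis .
qed

end

section \<open>Girth cycles through an edge\<close>

lemma path_edges_append':
  "xs \<noteq> [] \<Longrightarrow> ys \<noteq> [] \<Longrightarrow>
    path_edges (xs @ ys) = path_edges xs \<union> {{last xs, hd ys}} \<union> path_edges ys"
proof (induction xs)
  case (Cons x xs)
  then show ?case by (cases xs; cases ys) auto
qed simp

lemma path_edges_memD:
  "e \<in> path_edges zs \<Longrightarrow> \<exists>xs x y ys. zs = xs @ x # y # ys \<and> e = {x, y}"
proof (induction zs rule: path_edges.induct)
  case (1 x y zs)
  show ?case
  proof (cases "e = {x, y}")
    case True
    thus ?thesis by (intro exI[of _ "[]"]) auto
  next
    case False
    with 1 obtain xs a b ys where "y # zs = xs @ a # b # ys \<and> e = {a, b}" by auto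
    thus ?thesis by (intro exI[of _ "x # xs"]) auto
  qed
qed auto

definition cycle_edges :: "'a list \<Rightarrow> 'a set set" where
  "cycle_edges xs = path_edges (last xs # xs)"

lemma cycle_edges_alt: "xs \<noteq> [] \<Longrightarrow> cycle_edges xs = insert {last xs, hd xs} (path_edges xs)"
  by (cases xs) (auto simp: cycle_edges_def)

context simple_graph
begin

lemma vertex_cycle_rotate:
  assumes "vertex_cycle A (xs @ ys)" "xs \<noteq> []" "ys \<noteq> []"
  shows "vertex_cycle A (ys @ xs)"
  using assms by (auto simp: vertex_cycle_def successively_append_iff)

lemma vertex_cycle_rev: "vertex_cycle A xs \<Longrightarrow> vertex_cycle A (rev xs)"
  unfolding vertex_cycle_def
proof (elim conjE, intro conjI)
  assume xs: "3 \<le> length xs" "distinct xs" "successively A xs" "A (last xs) (hd xs)"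
  show "successively A (rev xs)"
    using xs(3) unfolding successively_rev by (rule successively_mono) (auto intro: sym)
  show "A (last (rev xs)) (hd (rev xs))"
    using xs(1) sym[OF xs(4)] by (simp add: hd_rev last_rev)
qed auto

text \<open>Rotation makes the given edge the closing edge; reversal, if needed, puts
  \<open>u\<close> first.\<close>

lemma cycle_through_edge:
  assumes "vertex_cycle A xs" "{u, v} \<in> cycle_edges xs"
  obtains ys where "vertex_cycle A ys" "length ys = length xs" "cycle_edges ys = cycle_edges xs"
    "hd ys = u" "last ys = v"
proof -
  have ne: "xs \<noteq> []" using assms(1) by (auto simp: vertex_cycle_def)
  obtain as x y bs where dec: "last xs # xs = as @ x # y # bs" "{u, v} = {x, y}"
    using path_edges_memD assms(2) unfolding cycle_edges_def by metis
  have "\<exists>ys. vertex_cycle A ys \<and> length ys = length xs \<and> cycle_edges ys = cycle_edges xs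
    \<and> hd ys = y \<and> last ys = x"
  proof (cases as)
    case Nil
    thus ?thesis using dec assms(1) by (intro exI[of _ xs]) auto
  next
    case (Cons a as')
    hence xs: "xs = (as' @ [x]) @ (y # bs)" using dec by auto
    have "vertex_cycle A ((y # bs) @ (as' @ [x]))"
      using assms(1) unfolding xs by (rule vertex_cycle_rotate) auto
    moreover have "cycle_edges ((y # bs) @ (as' @ [x])) = cycle_edges xs"
      unfolding xs by (subst (1 2) cycle_edges_alt, simp, simp, subst (1 2) path_edges_append')
        (auto simp: hd_append)
    ultimately show ?thesis unfolding xs by (intro exI[of _ "(y # bs) @ (as' @ [x])"]) auto
  qed
  then obtain ys where ys: "vertex_cycle A ys" "length ys = length xs" "cycle_edges ys = cycle_edges xs"
    "hd ys = y" "last ys = x" by blast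
  have ne': "ys \<noteq> []" using ys(2) ne by auto
  show ?thesis
  proof (cases "u = y")
    case True
    hence "v = x" using dec(2) by (metis doubleton_eq_iff)
    thus ?thesis using True ys that by blast
  next
    case False
    hence "u = x" "v = y" using dec(2) by (auto simp: doubleton_eq_iff)
    moreover have "cycle_edges (rev ys) = cycle_edges ys"
      using ne' by (auto simp: cycle_edges_alt path_edges_rev hd_rev last_rev insert_commute)
    ultimately show ?thesis
      using that[of "rev ys"] ys ne' vertex_cycle_rev[of ys] by (auto simp: hd_rev last_rev)
  qed
qed

text \<open>With \<open>uv\<close> as the closing edge, the vertex at position \<open>k\<close> is
  opposite to it. The two halves, one of them reversed, lead to it from \<open>u\<close> and from
  \<open>v\<close>; since the vertices of the cycle are distinct, prefixing the other end of
  \<open>uv\<close> creates no backtracking.\<close>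

lemma odd_cycle_split:
  assumes "vertex_cycle A xs" "length xs = 2 * k + 1" "{u, v} \<in> cycle_edges xs"
  obtains us vs where "length us = k" "length vs = k"
    "nb_walk A (v # u # us)" "nb_walk A (u # v # vs)" "last (u # us) = last (v # vs)"
    "cycle_edges xs = insert {u, v} (path_edges (u # us) \<union> path_edges (v # vs))"
proof -
  obtain ys where ys: "vertex_cycle A ys" "length ys = length xs" "cycle_edges ys = cycle_edges xs"
    "hd ys = u" "last ys = v"
    using cycle_through_edge[OF assms(1,3)] by blast
  have k: "k > 0" using assms(1,2) by (cases k) (auto simp: vertex_cycle_def)
  define ps w qs where "ps = take k ys" and "w = ys ! k" and "qs = drop (Suc k) ys"
  have dec: "ys = ps @ w # qs"
    using ys(2) assms(2) unfolding ps_def w_def qs_def by (intro id_take_nth_drop) auto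
  have len: "length ps = k" "length qs = k"
    using ys(2) assms(2) by (auto simp: ps_def qs_def)
  from len k obtain ps' where ps: "ps = u # ps'" using ys(4) dec by (cases ps) auto
  from len k obtain qs' where qs: "qs = qs' @ [v]" using ys(5) dec by (cases qs rule: rev_cases) auto
  define us vs where "us = ps' @ [w]" and "vs = rev qs' @ [w]"
  have uus: "u # us = ps @ [w]" and vvs: "v # vs = rev (w # qs)"
    by (auto simp: us_def vs_def ps qs)
  have d: "distinct ys" "successively A ys" "A v u"
    using ys by (auto simp: vertex_cycle_def)
  have sw: "successively A (w # qs)" "successively A (ps @ [w])"
    using d(2) unfolding dec by (auto simp: successively_append_iff successively_Cons)
  show ?thesis
  proof (rule that)
    show "length us = k" "length vs = k" using len ps qs by (auto simp: us_def vs_def)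
    have "distinct (v # u # us)" unfolding uus using d(1) dec qs by auto
    moreover have "successively A (v # u # us)"
      using sw(2) d(3) unfolding uus[symmetric] by simp
    ultimately show "nb_walk A (v # u # us)" by (intro distinct_successively_nb_walk) auto
    have "distinct (u # v # vs)" unfolding vvs using d(1) dec ps by auto
    moreover have "successively A (rev (w # qs))"
      using sw(1) unfolding successively_rev by (rule successively_mono) (auto intro: sym)
    hence "successively A (u # v # vs)" using sym[OF d(3)] unfolding vvs[symmetric] by simp
    ultimately show "nb_walk A (u # v # vs)" by (intro distinct_successively_nb_walk) auto
    show "last (u # us) = last (v # vs)" by (simp add: us_def vs_def)
    have "cycle_edges xs = insert {v, u} (path_edges ys)"
      using ys(3-5) cycle_edges_alt[of ys] dec by simp
    also have "path_edges ys = path_edges (u # us) \<union> path_edges (v # vs)"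
      unfolding uus vvs path_edges_rev dec by (rule path_edges_append)
    finally show "cycle_edges xs = insert {u, v} (path_edges (u # us) \<union> path_edges (v # vs))"
      by (simp add: insert_commute)
  qed
qed

end

context cubic_graph
begin

text \<open>
  A girth cycle through \<open>uv\<close> is determined by the vertex opposite to \<open>uv\<close>, which is an
  element of \<open>branch A d v u\<close>; as this set has at most \<open>2 ^ d\<close> elements, all of them occur.
\<close>

lemma reach_subset_if_max_cycles:
  assumes uv: "A u v" and card: "card Cs = 2 ^ d"
    and Cs: "\<And>C. C \<in> Cs \<Longrightarrow>
      \<exists>xs. vertex_cycle A xs \<and> length xs = 2 * d + 1 \<and> {u, v} \<in> C \<and> C = cycle_edges xs"
    and x: "reach A d u x"
  shows "reach A d v x"
proof -
  define P where "P C w us vs \<longleftrightarrow> length us = d \<and> length vs = d \<and>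
    nb_walk A (v # u # us) \<and> nb_walk A (u # v # vs) \<and> last (u # us) = w \<and> last (v # vs) = w \<and>
    C = insert {u, v} (path_edges (u # us) \<union> path_edges (v # vs))" for C w us vs
  have "\<exists>w us vs. P C w us vs" if "C \<in> Cs" for C
    using Cs[OF that] odd_cycle_split[of _ d u v] unfolding P_def by metis
  then obtain f where f: "\<And>C. C \<in> Cs \<Longrightarrow> \<exists>us vs. P C (f C) us vs" by metis
  have uniq: "C = C'" if "P C w us vs" "P C' w us' vs'" for C C' w us vs us' vs'
  proof -
    have "u # us = u # us'"
      using that nb_walk_append2[of A "[v]"] by (intro nb_walk_unique) (auto simp: P_def)
    moreover have "v # vs = v # vs'"
      using that nb_walk_append2[of A "[u]"] by (intro nb_walk_unique) (auto simp: P_def)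
    ultimately show ?thesis using that by (simp add: P_def)
  qed
  have "inj_on f Cs" using f uniq by (intro inj_onI) metis
  hence "card (f ` Cs) = 2 ^ d" using card by (simp add: card_image)
  moreover have "f ` Cs \<subseteq> branch A d v u"
    using f nb_walk_branch[of A v u] unfolding P_def by fastforce
  moreover have "card (branch A d v u) \<le> 2 ^ d" "finite (branch A d v u)"
    using card_branch[OF sym[OF uv]] by auto
  ultimately have eq: "f ` Cs = branch A d v u" by (intro card_seteq) auto
  have branch: "reach A d v w" if w: "w \<in> branch A d v u" for w
  proof -
    obtain C where "C \<in> Cs" "w = f C" using w eq by auto
    then obtain us vs where "P C w us vs" using f by blast
    thus ?thesis using nb_walk_reach[of A "v # vs" d] nb_walk_append2[of A "[u]" "v # vs"]
      by (auto simp: P_def)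
  qed
  obtain us where us: "nb_walk A (u # us)" "last (u # us) = x" "length us \<le> d"
    using reach_nb_walk[OF x] by blast
  \<comment> \<open>A walk through \<open>v\<close> just loses its first vertex. Any other walk can
    be prefixed by \<open>v\<close>: if it is shorter than \<open>d\<close> it stays short enough,
    and if it has length \<open>d\<close> it ends in the branch, whose vertices are opposite
    vertices of girth cycles.\<close>
  show ?thesis
  proof (cases "us \<noteq> [] \<and> hd us = v")
    case True
    then obtain vs where "us = v # vs" by (cases us) auto
    thus ?thesis using nb_walk_reach[of A us d] us nb_walk_append2[of A "[u]" us] by auto
  next
    case False
    hence nb: "nb_walk A (v # u # us)" using us sym[OF uv] by (auto simp: nb_walk_Cons_iff)
    show ?thesis
    proof (cases "length us = d")
      case True
      thus ?thesis using branch nb_walk_branch[OF nb] us by auto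
    next
      case False
      thus ?thesis using nb_walk_reach[OF nb, of d] us by auto
    qed
  qed
qed

lemma full_if_max_cycles:
  assumes "A u v" "card Cs = 2 ^ d"
    and "\<And>C. C \<in> Cs \<Longrightarrow>
      \<exists>xs. vertex_cycle A xs \<and> length xs = 2 * d + 1 \<and> {u, v} \<in> C \<and> C = cycle_edges xs"
  shows "full u v"
proof -
  have "\<exists>xs. vertex_cycle A xs \<and> length xs = 2 * d + 1 \<and> {v, u} \<in> C \<and> C = cycle_edges xs"
    if "C \<in> Cs" for C
    using assms(3)[OF that] by (simp add: insert_commute)
  from reach_subset_if_max_cycles[OF sym[OF assms(1)] assms(2) this]
    reach_subset_if_max_cycles[OF assms]
  have "reach A d u x = reach A d v x" for x by blast
  thus ?thesis using assms(1) by (auto simp: full_def)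
qed

end

section \<open>Moore graphs: girth at least \<open>2 * d + 1\<close> and diameter at most
  \<open>d\<close>\<close>

locale cubic_moore_graph = cubic_graph +
  assumes diameter: "x \<in> V \<Longrightarrow> y \<in> V \<Longrightarrow> reach A d x y"
begin

text \<open>The recurrence of \<open>moore_poly\<close>, entry by entry: all three neighbours count
  if \<open>y\<close> is within \<open>i\<close> of \<open>x\<close>, exactly one at distance
  \<open>i + 1\<close> or \<open>i + 2\<close> by \<open>two_nbrs_closer\<close>, and none
  beyond.\<close>

lemma card_closer_nbrs:
  assumes x: "x \<in> V" and i: "Suc (Suc i) \<le> d"
  shows "card {z. A x z \<and> reach A (Suc i) z y} =
    of_bool (reach A (Suc (Suc i)) x y) + 2 * of_bool (reach A i x y)"
proof (cases "reach A i x y")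
  case True
  have "reach A (Suc i) z y" if "A x z" for z
    using reach_step[OF sym[OF that] True] .
  hence "{z. A x z \<and> reach A (Suc i) z y} = {z. A x z}" by blast
  moreover have "reach A (Suc (Suc i)) x y" using True by (rule reach_mono) simp
  ultimately show ?thesis using cubic[OF x] True by simp
next
  case False
  show ?thesis
  proof (cases "reach A (Suc (Suc i)) x y")
    case True
    then obtain z where z: "A x z" "reach A (Suc i) z y"
      using False reach_refl[of A i x] by (elim reach_SucE) auto
    have "z' = z" if "A x z'" "reach A (Suc i) z' y" for z'
    proof (rule ccontr)
      assume "z' \<noteq> z"
      from two_nbrs_closer[OF that(1) z(1) this that(2) z(2)] i False show False by auto
    qed
    hence "{z. A x z \<and> reach A (Suc i) z y} = {z}" using z by blast
    thus ?thesis using True False by simp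
  next
    case nr: False
    hence empty: "{z. A x z \<and> reach A (Suc i) z y} = {}" using reach_step[of A x _ "Suc i" y] by blast
    show ?thesis unfolding empty using nr False by (simp del: reach.simps)
  qed
qed

lemma complete_if_d_1:
  assumes "d = 1" "x \<in> V" "y \<in> V" "x \<noteq> y"
  shows "A x y"
  using diameter[OF assms(2,3)] assms(1,4) by auto

lemma card_V_if_d_1:
  assumes "d = 1" "x \<in> V"
  shows "card V = 4"
proof -
  have "V = insert x {y. A x y}"
    using complete_if_d_1[OF assms] adj_V' assms(2) by auto
  moreover have "card (insert x {y. A x y}) = Suc (card {y. A x y})"
    using finite_nbrs irrefl by (intro card_insert_disjoint) auto
  ultimately show ?thesis using cubic[OF assms(2)] by simp
qed

end

section \<open>Diameter 2: the structure of the Petersen graph\<close>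

locale cubic_moore_graph_2 = cubic_moore_graph +
  assumes d2: "d = 2"
begin

lemma no_triangle: "A x y \<Longrightarrow> A y z \<Longrightarrow> A x z \<Longrightarrow> False"
  using girth_ge[of "[x, y, z]"] irrefl sym[of x z] by (auto simp: vertex_cycle_def d2)

lemma no_square: "A x y \<Longrightarrow> A y z \<Longrightarrow> A x w \<Longrightarrow> A w z \<Longrightarrow> x \<noteq> z \<Longrightarrow> y = w"
  using girth_ge[of "[x, y, z, w]"] irrefl sym[of x w] sym[of w z]
  by (auto simp: vertex_cycle_def d2)

lemma reach_2: "x \<in> V \<Longrightarrow> y \<in> V \<Longrightarrow> x = y \<or> A x y \<or> (\<exists>z. A x z \<and> A z y)"
  using diameter[of x y] by (auto simp: d2 numeral_2_eq_2)

lemma other_nbrs: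
  assumes "A x y"
  obtains z w where "\<And>t. A x t \<longleftrightarrow> t = y \<or> t = z \<or> t = w" "z \<noteq> y" "w \<noteq> y" "z \<noteq> w"
proof -
  have "card ({t. A x t} - {y}) = 2"
    using cubic[OF adj_V[OF assms]] assms finite_nbrs[of x] by simp
  then obtain z w where zw: "{t. A x t} - {y} = {z, w}" "z \<noteq> w" by (auto simp: card_2_iff)
  hence "z \<in> {t. A x t} - {y}" "w \<in> {t. A x t} - {y}" by auto
  moreover have "A x t \<longleftrightarrow> t \<in> insert y ({t. A x t} - {y})" for t using assms by auto
  hence "A x t \<longleftrightarrow> t = y \<or> t = z \<or> t = w" for t unfolding zw by auto
  ultimately show ?thesis using that zw(2) by blast
qed

lemma nbrs_eqI:
  assumes "A x y" "A x z" "A x w" "y \<noteq> z" "y \<noteq> w" "z \<noteq> w"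
  shows "A x t \<longleftrightarrow> t = y \<or> t = z \<or> t = w"
proof -
  have "{y, z, w} = {t. A x t}"
    using cubic[OF adj_V[OF assms(1)]] finite_nbrs[of x] assms by (intro card_seteq) auto
  thus ?thesis by blast
qed

text \<open>Start from an edge \<open>uv\<close> with further neighbours \<open>a\<close>,
  \<open>a'\<close> of \<open>u\<close> and \<open>b\<close>, \<open>b'\<close> of \<open>v\<close>.
  Each of the four pairs of one \<open>a\<close> and one \<open>b\<close> has a common neighbour;
  these are \<open>p\<close>, \<open>q\<close>, \<open>r\<close>, \<open>s\<close>. The last two
  edges, \<open>ps\<close> and \<open>qr\<close>, are then forced.\<close>

lemma petersen_structure:
  assumes "V \<noteq> {}"
  obtains u v a a' b b' p q r s where
    "V = {u, v, a, a', b, b', p, q, r, s}" "distinct [u, v, a, a', b, b', p, q, r, s]"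
    "\<forall>t. A u t \<longleftrightarrow> t = v \<or> t = a \<or> t = a'" "\<forall>t. A v t \<longleftrightarrow> t = u \<or> t = b \<or> t = b'"
    "\<forall>t. A a t \<longleftrightarrow> t = u \<or> t = p \<or> t = q" "\<forall>t. A a' t \<longleftrightarrow> t = u \<or> t = r \<or> t = s"
    "\<forall>t. A b t \<longleftrightarrow> t = v \<or> t = p \<or> t = r" "\<forall>t. A b' t \<longleftrightarrow> t = v \<or> t = q \<or> t = s"
    "\<forall>t. A p t \<longleftrightarrow> t = a \<or> t = b \<or> t = s" "\<forall>t. A q t \<longleftrightarrow> t = a \<or> t = b' \<or> t = r"
    "\<forall>t. A r t \<longleftrightarrow> t = a' \<or> t = b \<or> t = q" "\<forall>t. A s t \<longleftrightarrow> t = a' \<or> t = b' \<or> t = p"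
proof -
  obtain u where uV: "u \<in> V" using assms by blast
  have "{t. A u t} \<noteq> {}" using cubic[OF uV] by (metis card.empty zero_neq_numeral)
  then obtain v where uv: "A u v" by blast
  obtain a a' where Nu: "\<And>t. A u t \<longleftrightarrow> t = v \<or> t = a \<or> t = a'" and aa: "a \<noteq> v" "a' \<noteq> v" "a \<noteq> a'"
    using other_nbrs[OF uv] by metis
  obtain b b' where Nv: "\<And>t. A v t \<longleftrightarrow> t = u \<or> t = b \<or> t = b'" and bb: "b \<noteq> u" "b' \<noteq> u" "b \<noteq> b'"
    using other_nbrs[OF sym[OF uv]] by metis
  have ua: "A u a" "A u a'" and vb: "A v b" "A v b'" by (auto simp: Nu Nv)
  \<comment> \<open>Equality of \<open>x\<close> and \<open>y\<close> would give a triangle and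
    adjacency a square, so diameter 2 leaves a common neighbour.\<close>
  have mid: "\<exists>w. A x w \<and> A w y" if "A u x" "A v y" "x \<noteq> v" "y \<noteq> u" for x y
  proof -
    have "x \<noteq> y" using that no_triangle[of u v x] uv by auto
    moreover have "\<not> A x y" using that no_square[of u v y x] uv by blast
    ultimately show ?thesis using reach_2[of x y] that adj_V' by blast
  qed
  obtain p where p: "A a p" "A p b" using mid[OF ua(1) vb(1)] aa bb by blast
  obtain q where q: "A a q" "A q b'" using mid[OF ua(1) vb(2)] aa bb by blast
  obtain r where r: "A a' r" "A r b" using mid[OF ua(2) vb(1)] aa bb by blast
  obtain s where s: "A a' s" "A s b'" using mid[OF ua(2) vb(2)] aa bb by blast
  have notu: "w \<noteq> u" if "A w y" "A v y" "y \<noteq> u" for w y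
    using that no_triangle[of u v y] uv by blast
  have notv: "w \<noteq> v" if "A x w" "A u x" "x \<noteq> v" for w x
    using that no_triangle[of u x v] uv by blast
  have pu: "p \<noteq> u" "q \<noteq> u" "r \<noteq> u" "s \<noteq> u" using notu p q r s vb bb by blast+
  have pv: "p \<noteq> v" "q \<noteq> v" "r \<noteq> v" "s \<noteq> v" using notv p q r s ua aa by blast+
  have pq: "p \<noteq> q" "r \<noteq> s"
    using no_square[of b p b' v] no_square[of b r b' v] p q r s vb bb pv sym by metis+
  have pr: "p \<noteq> r" "q \<noteq> s"
    using no_square[of a p a' u] no_square[of a q a' u] p q r s ua aa pu sym by metis+
  have Na: "A a t \<longleftrightarrow> t = u \<or> t = p \<or> t = q" for t
    using p q pu pq sym[OF ua(1)] by (intro nbrs_eqI) auto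
  have Na': "A a' t \<longleftrightarrow> t = u \<or> t = r \<or> t = s" for t
    using r s pu pq sym[OF ua(2)] by (intro nbrs_eqI) auto
  have Nb: "A b t \<longleftrightarrow> t = v \<or> t = p \<or> t = r" for t
    using sym[OF p(2)] sym[OF r(2)] pv pr sym[OF vb(1)] by (intro nbrs_eqI) auto
  have Nb': "A b' t \<longleftrightarrow> t = v \<or> t = q \<or> t = s" for t
    using sym[OF q(2)] sym[OF s(2)] pv pr sym[OF vb(2)] by (intro nbrs_eqI) auto
  have V: "V = {u, v, a, a', b, b', p, q, r, s}"
  proof
    show "V \<subseteq> {u, v, a, a', b, b', p, q, r, s}"
      using reach_2[OF uV] unfolding Nu using Nv Na Na' by blast
    show "{u, v, a, a', b, b', p, q, r, s} \<subseteq> V"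
      using uV adj_V'[OF uv] ua vb p q r s adj_V' by blast
  qed
  \<comment> \<open>Stated for arbitrary names because it serves for both \<open>ps\<close> and
    \<open>qr\<close>: the third neighbour of \<open>p'\<close> is found by excluding every other
    vertex by a triangle or a square.\<close>
  have opp: "A p' s'"
    if h: "A u x" "A u x'" "x \<noteq> x'" "A v y" "A v y'" "y \<noteq> y'" "x \<noteq> v" "x' \<noteq> v" "y \<noteq> u" "y' \<noteq> u"
      "A x p'" "A p' y" "A x q'" "A r' y"
      "V = {u, v, x, x', y, y', p', q', r', s'}" for x x' y y' p' q' r' s'
  proof -
    obtain z w where zw: "\<And>t. A p' t \<longleftrightarrow> t = x \<or> t = z \<or> t = w" "z \<noteq> x" "w \<noteq> x" "z \<noteq> w"
      using other_nbrs[OF sym[OF h(11)]] by metis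
    have xy': "A x' p' \<Longrightarrow> False"
      using no_square[of u x p' x'] h notu[of p' y] sym by metis
    have yy': "A y' p' \<Longrightarrow> False"
      using no_square[of v y p' y'] h notv[of x p'] sym by metis
    have "\<exists>t. A p' t \<and> t \<noteq> x \<and> t \<noteq> y" using zw by metis
    then obtain t where t: "A p' t" "t \<noteq> x" "t \<noteq> y" by blast
    have "t \<noteq> u" using t no_triangle[of u x p'] h sym by blast
    moreover have "t \<noteq> v" using t no_triangle[of v y p'] h sym by blast
    moreover have "t \<noteq> x'"
      using t xy' sym by blast
    moreover have "t \<noteq> y'"
      using t yy' sym by blast
    moreover have "t \<noteq> p'" using t irrefl by blast
    moreover have "t \<noteq> q'" using t no_triangle[of x p' q'] h by blast
    moreover have "t \<noteq> r'" using t no_triangle[of y p' r'] h sym by blast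
    ultimately have "t = s'" using adj_V'[OF t(1)] t h by blast
    thus ?thesis using t by simp
  qed
  have ps: "A p s"
    by (rule opp[of a a' b b' p q r]) (use ua vb aa bb p q r s V in auto)
  have qr: "A q r"
    by (rule opp[of a a' b' b q p s]) (use ua vb aa bb p q r s V in auto)
  have dist: "distinct [u, v, a, a', b, b', p, q, r, s]"
  proof -
    have "u \<noteq> v" "u \<noteq> a" "u \<noteq> a'" "v \<noteq> b" "v \<noteq> b'" "a \<noteq> p" "a \<noteq> q" "a' \<noteq> r" "a' \<noteq> s"
      "b \<noteq> p" "b \<noteq> r" "b' \<noteq> q" "b' \<noteq> s"
      using uv ua vb p q r s irrefl by blast+
    moreover have "a \<noteq> b" "a \<noteq> b'" "a' \<noteq> b" "a' \<noteq> b'"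
      using no_triangle[OF uv] ua vb by blast+
    moreover have "a \<noteq> r" "a \<noteq> s" "a' \<noteq> p" "a' \<noteq> q"
      using no_triangle[OF ua(1)] no_triangle[OF ua(2)] ua p q r s by blast+
    moreover have "b \<noteq> q" "b \<noteq> s" "b' \<noteq> p" "b' \<noteq> r"
      using no_triangle[OF vb(1)] no_triangle[OF vb(2)] vb p q r s by blast+
    moreover have "p \<noteq> s" "q \<noteq> r"
      using no_square[of a p a' u] no_square[of a q a' u] p q r s ua aa pu sym by metis+
    ultimately show ?thesis using aa bb pu pv pq pr by auto
  qed
  show ?thesis
  proof (rule that[OF V dist])
    show "\<forall>t. A u t \<longleftrightarrow> t = v \<or> t = a \<or> t = a'" "\<forall>t. A v t \<longleftrightarrow> t = u \<or> t = b \<or> t = b'"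
      "\<forall>t. A a t \<longleftrightarrow> t = u \<or> t = p \<or> t = q" "\<forall>t. A a' t \<longleftrightarrow> t = u \<or> t = r \<or> t = s"
      "\<forall>t. A b t \<longleftrightarrow> t = v \<or> t = p \<or> t = r" "\<forall>t. A b' t \<longleftrightarrow> t = v \<or> t = q \<or> t = s"
      using Nu Nv Na Na' Nb Nb' by blast+
    show "\<forall>t. A p t \<longleftrightarrow> t = a \<or> t = b \<or> t = s"
      using dist sym[OF p(1)] p(2) ps by (intro allI nbrs_eqI) auto
    show "\<forall>t. A q t \<longleftrightarrow> t = a \<or> t = b' \<or> t = r"
      using dist sym[OF q(1)] q(2) qr by (intro allI nbrs_eqI) auto
    show "\<forall>t. A r t \<longleftrightarrow> t = a' \<or> t = b \<or> t = q"
      using dist sym[OF r(1)] r(2) sym[OF qr] by (intro allI nbrs_eqI) auto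
    show "\<forall>t. A s t \<longleftrightarrow> t = a' \<or> t = b' \<or> t = p"
      using dist sym[OF s(1)] s(2) sym[OF ps] by (intro allI nbrs_eqI) auto
  qed
qed

end

section \<open>The spectrum of a cubic Moore graph\<close>

text \<open>The primitive part \<open>f\<close> of the quadratic is the minimal polynomial of
  \<open>l\<close> up to a factor, so it divides \<open>p\<close> over the integers by Gauss's lemma
  and has leading coefficient 1 or -1. Thus \<open>S\<close> and \<open>Q\<close> are the trace and
  norm of \<open>l\<close>, and its conjugate is a root of \<open>p\<close> too.\<close>

lemma irrational_quadratic_root_of_monic_int_poly:
  fixes p :: "int poly" and l :: complex and a b c :: int
  assumes monic: "lead_coeff p = 1"
    and root: "poly (of_int_poly p) l = 0"
    and quad: "of_int a * l\<^sup>2 + of_int b * l + of_int c = 0" "a \<noteq> 0"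
    and irrat: "l \<notin> \<rat>"
  obtains S Q :: int where "b = - a * S" "c = a * Q"
    "\<And>x :: complex. x\<^sup>2 - of_int S * x + of_int Q = 0 \<Longrightarrow> poly (of_int_poly p) x = 0"
proof -
  define q where "q = [:c, b, a:]"
  define f where "f = primitive_part q"
  have q0: "q \<noteq> 0" "degree q = 2" using quad(2) by (auto simp: q_def)
  define k where "k = content q"
  have k0: "k \<noteq> 0" using q0 by (simp add: k_def)
  have qf: "q = smult k f" by (simp add: f_def k_def)
  have prim: "content f = 1" using q0 by (simp add: f_def)
  have degf: "degree f = 2" using q0(2) by (simp add: f_def)
  have f0: "f \<noteq> 0" using degf by auto
  define A B C where "A = coeff f 2" and "B = coeff f 1" and "C = coeff f 0"
  have fABC: "f = [:C, B, A:]"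
    using degf by (intro poly_eqI)
      (auto simp: A_def B_def C_def coeff_pCons coeff_eq_0 numeral_2_eq_2 split: nat.splits)
  have abc: "a = k * A" "b = k * B" "c = k * C"
    using qf unfolding q_def fABC by auto
  have fl: "of_int A * l\<^sup>2 + of_int B * l + of_int C = 0"
  proof -
    have "of_int k * (of_int A * l\<^sup>2 + of_int B * l + of_int C) = (0 :: complex)"
      using quad(1) unfolding abc by (simp add: algebra_simps)
    thus ?thesis using k0 by simp
  qed
  obtain g r where gr: "pseudo_divmod p f = (g, r)" by force
  from pseudo_divmod[OF f0 gr] obtain N where
    N: "smult (A ^ N) p = f * g + r" and r: "r = 0 \<or> degree r < 2"
    unfolding degf using degf by (auto simp: A_def)
  have A0: "A \<noteq> 0" using degf f0 by (metis A_def leading_coeff_0_iff)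
  have r1: "r = [:coeff r 0, coeff r 1:]"
    using r by (intro poly_eqI)
      (auto simp: coeff_pCons coeff_eq_0 numeral_2_eq_2 split: nat.splits)
  have "poly (of_int_poly (smult (A ^ N) p)) l = 0"
    using root by (simp add: of_int_hom.map_poly_hom_smult)
  moreover have "poly (of_int_poly f) l = 0"
    using fl by (simp add: fABC of_int_hom.map_poly_pCons_hom power2_eq_square algebra_simps)
  ultimately have "poly (of_int_poly r) l = 0"
    unfolding N by (simp add: of_int_poly_hom.hom_add of_int_poly_hom.hom_mult)
  hence rl: "of_int (coeff r 0) + l * of_int (coeff r 1) = 0"
    by (subst (asm) r1) (simp add: of_int_hom.map_poly_pCons_hom algebra_simps)
  \<comment> \<open>A linear remainder that vanishes at \<open>l\<close> would make \<open>l\<close>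
    rational.\<close>
  have "coeff r 1 = 0"
  proof (rule ccontr)
    assume "coeff r 1 \<noteq> 0"
    hence "l = - of_int (coeff r 0) / of_int (coeff r 1)"
      using rl by (simp add: field_simps) (metis add_eq_0_iff)
    thus False using irrat by simp
  qed
  with rl r1 have "r = 0" by auto
  hence "f dvd smult (A ^ N) p" using N by simp
  hence "fract_poly f dvd smult (to_fract (A ^ N)) (fract_poly p)"
    by (metis fract_poly_dvd fract_poly_smult)
  hence "fract_poly f dvd fract_poly p"
    using A0 by (simp add: dvd_smult_cancel)
  hence fp: "f dvd p" using prim by (rule fract_poly_dvdD)
  then obtain h where h: "p = f * h" ..
  have "lead_coeff f dvd 1" using monic h by (metis dvd_triv_left lead_coeff_mult)
  hence "A dvd 1" using degf by (simp add: A_def)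
  \<comment> \<open>The unit \<open>A\<close> is its own inverse, so multiplying by it makes the
    quadratic monic.\<close>
  hence A1: "A * A = 1" by (auto simp: zdvd1_eq abs_if split: if_splits)
  show ?thesis
  proof (rule that[of "- B * A" "C * A"])
    show "b = - a * (- B * A)" "c = a * (C * A)"
      using A1 unfolding abc by (simp_all add: algebra_simps)
    fix x :: complex assume "x\<^sup>2 - of_int (- B * A) * x + of_int (C * A) = 0"
    hence "of_int A * (x\<^sup>2 - of_int (- B * A) * x + of_int (C * A)) = (0::complex)" by simp
    hence "of_int A * x\<^sup>2 + of_int (A * A) * of_int B * x + of_int (A * A) * of_int C = (0::complex)"
      by (simp add: algebra_simps)
    hence "of_int A * x\<^sup>2 + of_int B * x + of_int C = (0::complex)"
      unfolding A1 by simp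
    hence "poly (of_int_poly f) x = 0" by (simp add: fABC of_int_hom.map_poly_pCons_hom power2_eq_square algebra_simps)
    thus "poly (of_int_poly p) x = 0"
      unfolding h by (simp add: of_int_poly_hom.hom_mult)
  qed
qed

section \<open>Polynomials for balls and the location of their roots\<close>

text \<open>
  In a cubic graph of girth greater than \<open>2 * i\<close> with adjacency matrix \<open>A\<close>, the matrix
  \<open>moore_poly i\<close> evaluated at \<open>A\<close> is the indicator matrix of the pairs at distance at most \<open>i\<close>.
\<close>

fun moore_poly :: "nat \<Rightarrow> 'a :: comm_ring_1 poly" where
  "moore_poly 0 = 1"
| "moore_poly (Suc 0) = [:1, 1:]"
| "moore_poly (Suc (Suc i)) = pCons 0 (moore_poly (Suc i)) - smult 2 (moore_poly i)"

lemma of_int_moore_poly: "of_int_poly (moore_poly i) = (moore_poly i :: complex poly)"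
  by (induction i rule: moore_poly.induct)
     (simp_all add: of_int_poly_hom.hom_minus of_int_hom.map_poly_hom_smult of_int_hom.map_poly_pCons_hom)

lemma degree_moore_poly: "degree (moore_poly i :: 'a :: idom poly) = i"
  and lead_coeff_moore_poly: "lead_coeff (moore_poly i :: 'a :: idom poly) = 1"
proof -
  have "degree (moore_poly i :: 'a poly) = i \<and> lead_coeff (moore_poly i :: 'a poly) = 1"
  proof (induction i rule: moore_poly.induct)
    case (3 i)
    let ?p = "pCons 0 (moore_poly (Suc i)) :: 'a poly"
    let ?q = "- smult 2 (moore_poly i) :: 'a poly"
    have "moore_poly (Suc i) \<noteq> (0 :: 'a poly)" using 3 by auto
    hence p: "degree ?p = Suc (Suc i)" "lead_coeff ?p = 1"
      using 3 by (auto simp: degree_pCons_eq)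
    have "degree ?q < degree ?p"
      unfolding p using 3 degree_smult_le[of 2 "moore_poly i :: 'a poly"] by simp
    from degree_add_eq_left[OF this] lead_coeff_add_le[of ?q ?p] this p
    show ?case by (simp add: coeff_eq_0)
  qed simp_all
  thus "degree (moore_poly i :: 'a poly) = i" "lead_coeff (moore_poly i :: 'a poly) = 1" by auto
qed

text \<open>Rescaled Chebyshev polynomials of the second kind:
  \<open>2 ^ (i / 2) * U_i (x / (2 * sqrt 2))\<close>.\<close>

fun tree_poly :: "nat \<Rightarrow> 'a :: comm_ring_1 \<Rightarrow> 'a" where
  "tree_poly 0 x = 1"
| "tree_poly (Suc 0) x = x"
| "tree_poly (Suc (Suc i)) x = x * tree_poly (Suc i) x - 2 * tree_poly i x"

lemma poly_moore_poly_Suc: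
  "poly (moore_poly (Suc i)) x = tree_poly (Suc i) x + tree_poly i (x :: 'a :: comm_ring_1)"
proof (induction i rule: moore_poly.induct)
  case (3 i)
  have "poly (moore_poly (Suc (Suc (Suc i)))) x =
      x * poly (moore_poly (Suc (Suc i))) x - 2 * poly (moore_poly (Suc i)) x"
    by (simp only: moore_poly.simps poly_diff poly_pCons poly_smult add_0)
  thus ?case unfolding 3 by (simp add: algebra_simps)
qed (simp_all add: algebra_simps)

text \<open>A common root of two consecutive terms would descend along the recurrence to
  \<open>tree_poly 0\<close>, which is 1.\<close>

lemma tree_poly_no_common_root:
  "\<not> (tree_poly i x = 0 \<and> tree_poly (Suc i) x = (0 :: 'a :: field_char_0))"
  by (induction i) auto

text \<open>By induction: \<open>x\<close> contributes a factor of at least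
  \<open>2 * sqrt 2\<close>, and the subtracted term costs at most \<open>sqrt 2\<close> of
  it.\<close>

lemma tree_poly_growth:
  fixes x :: complex
  assumes "2 * sqrt 2 \<le> cmod x"
  shows "sqrt 2 * cmod (tree_poly i x) \<le> cmod (tree_poly (Suc i) x)"
proof (induction i)
  case 0
  have "sqrt 2 \<le> cmod x" using assms real_sqrt_ge_zero[of 2] by linarith
  thus ?case by simp
next
  case (Suc i)
  let ?a = "cmod (tree_poly i x)" and ?b = "cmod (tree_poly (Suc i) x)"
  have "2 * ?a = sqrt 2 * (sqrt 2 * ?a)" by simp
  also have "\<dots> \<le> sqrt 2 * ?b" using Suc by (intro mult_left_mono) auto
  finally have 1: "2 * ?a \<le> sqrt 2 * ?b" .
  have 2: "2 * sqrt 2 * ?b \<le> cmod x * ?b" using assms by (intro mult_right_mono) auto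
  have "cmod x * ?b - 2 * ?a \<le> cmod (x * tree_poly (Suc i) x - 2 * tree_poly i x)"
    using norm_triangle_ineq2[of "x * tree_poly (Suc i) x" "2 * tree_poly i x"]
    by (simp add: norm_mult)
  thus ?case using 1 2 by simp
qed

lemma moore_poly_root_tree_poly:
  assumes "poly (moore_poly (Suc i)) (x :: 'a :: field_char_0) = 0"
  shows "tree_poly i x = - tree_poly (Suc i) x" "tree_poly (Suc i) x \<noteq> 0"
  using assms tree_poly_no_common_root[of i x]
  by (auto simp: poly_moore_poly_Suc add_eq_0_iff)

text \<open>At a root two consecutive values of \<open>tree_poly\<close> are opposite, hence equal
  in modulus, against growth by the factor \<open>sqrt 2\<close>.\<close>

lemma moore_poly_root_bound:
  assumes "poly (moore_poly d) (x :: complex) = 0"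
  shows "(cmod x)\<^sup>2 < 8"
proof (cases d)
  case (Suc i)
  note root = moore_poly_root_tree_poly[OF assms[unfolded Suc]]
  show ?thesis
  proof (rule ccontr)
    assume "\<not> ?thesis"
    hence "sqrt 8 \<le> cmod x" by (simp add: real_le_lsqrt)
    moreover have "sqrt 8 = 2 * sqrt 2" using real_sqrt_mult[of 4 2] by simp
    ultimately have "sqrt 2 * cmod (tree_poly i x) \<le> cmod (tree_poly (Suc i) x)"
      by (intro tree_poly_growth) simp
    hence "(sqrt 2 - 1) * cmod (tree_poly (Suc i) x) \<le> 0"
      using root(1) by (simp add: algebra_simps)
    thus False using root(2) by (simp add: mult_le_0_iff)
  qed
qed (use assms in simp)

text \<open>The divided difference of \<open>moore_poly i\<close> at \<open>l\<close> and
  \<open>x\<close>. The recurrence avoids division, so it also has a value at \<open>x = l\<close>,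
  namely the derivative.\<close>

fun moore_quot :: "nat \<Rightarrow> 'a :: comm_ring_1 \<Rightarrow> 'a \<Rightarrow> 'a" where
  "moore_quot 0 l x = 0"
| "moore_quot (Suc 0) l x = 1"
| "moore_quot (Suc (Suc i)) l x =
     poly (moore_poly (Suc i)) x + l * moore_quot (Suc i) l x - 2 * moore_quot i l x"

lemma moore_quot:
  "(x - l) * moore_quot i l x = poly (moore_poly i) x - poly (moore_poly i) (l :: 'a :: comm_ring_1)"
proof (induction i rule: moore_poly.induct)
  case (3 i)
  have "(x - l) * moore_quot (Suc (Suc i)) l x = (x - l) * poly (moore_poly (Suc i)) x
      + l * ((x - l) * moore_quot (Suc i) l x) - 2 * ((x - l) * moore_quot i l x)"
    by (simp add: algebra_simps)
  also have "\<dots> = poly (moore_poly (Suc (Suc i))) x - poly (moore_poly (Suc (Suc i))) l"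
    unfolding 3 by (simp add: algebra_simps)
  finally show ?case .
qed (simp_all add: algebra_simps)

lemma moore_quot_diag: "moore_quot i x x = poly (pderiv (moore_poly i)) (x :: 'a :: idom)"
  by (induction i rule: moore_poly.induct)
     (simp_all add: pderiv_pCons pderiv_diff pderiv_smult algebra_simps)

text \<open>The counterpart of the Chebyshev derivative formula, with \<open>8 - x^2\<close> in the
  place of \<open>1 - t^2\<close>.\<close>

lemma moore_quot_diag_eq:
  "(8 - x\<^sup>2) * moore_quot (Suc i) x x =
     of_nat (i + 2) * (4 + x) * tree_poly i x
       - of_nat (i + 1) * (x + 2) * tree_poly (Suc i) (x :: 'a :: comm_ring_1)"
proof (induction i rule: moore_poly.induct)
  case (3 i)
  have "(8 - x\<^sup>2) * moore_quot (Suc (Suc (Suc i))) x x =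
      (8 - x\<^sup>2) * poly (moore_poly (Suc (Suc i))) x
      + x * ((8 - x\<^sup>2) * moore_quot (Suc (Suc i)) x x) - 2 * ((8 - x\<^sup>2) * moore_quot (Suc i) x x)"
    by (simp add: algebra_simps)
  also have "\<dots> = of_nat (Suc (Suc i) + 2) * (4 + x) * tree_poly (Suc (Suc i)) x
       - of_nat (Suc (Suc i) + 1) * (x + 2) * tree_poly (Suc (Suc (Suc i))) x"
    unfolding 3 poly_moore_poly_Suc by (simp add: algebra_simps power2_eq_square)
  finally show ?case .
qed (simp_all add: algebra_simps power2_eq_square)

text \<open>With all traces equal to \<open>N\<close>, the sums satisfy
  \<open>T'' = N + l * T' - 2 * T\<close>. The constant solution is \<open>N / (3 - l)\<close>,
  whence the factor on the left.\<close>

lemma sum_list_moore_quot: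
  fixes es :: "'a :: comm_ring_1 list"
  assumes "\<And>i. i \<le> d \<Longrightarrow> (\<Sum>e\<leftarrow>es. poly (moore_poly i) e) = N" and "i < d"
  shows "(3 - l) * (\<Sum>e\<leftarrow>es. moore_quot (Suc i) l e) =
           N * (1 - tree_poly (Suc i) l + 2 * tree_poly i l)"
  using assms(2)
proof (induction i rule: moore_poly.induct)
  case 1
  thus ?case using assms(1)[of 0] by (simp add: algebra_simps)
next
  case 2
  have "(\<Sum>e\<leftarrow>es. moore_quot (Suc (Suc 0)) l e) = N + l * N"
    using assms(1)[of 0] assms(1)[of 1] 2 sum_list_const_mult[of l "\<lambda>_. 1" es]
    by (simp add: sum_list_addf algebra_simps)
  thus ?case by (simp only:) (simp add: algebra_simps)
next
  case (3 i)
  have "(\<Sum>e\<leftarrow>es. moore_quot (Suc (Suc (Suc i))) l e) =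
     (\<Sum>e\<leftarrow>es. poly (moore_poly (Suc (Suc i))) e)
     + l * (\<Sum>e\<leftarrow>es. moore_quot (Suc (Suc i)) l e) - 2 * (\<Sum>e\<leftarrow>es. moore_quot (Suc i) l e)"
    by (simp only: moore_quot.simps sum_list_addf sum_list_subtractf sum_list_const_mult)
  hence "(3 - l) * (\<Sum>e\<leftarrow>es. moore_quot (Suc (Suc (Suc i))) l e) =
     (3 - l) * N + l * ((3 - l) * (\<Sum>e\<leftarrow>es. moore_quot (Suc (Suc i)) l e))
       - 2 * ((3 - l) * (\<Sum>e\<leftarrow>es. moore_quot (Suc i) l e))"
    using assms(1)[of "Suc (Suc i)"] 3(3) by (simp only:) (simp add: algebra_simps)
  also have "\<dots> = N * (1 - tree_poly (Suc (Suc (Suc i))) l + 2 * tree_poly (Suc (Suc i)) l)"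
    using 3 by (simp only: Suc_lessD) (simp add: algebra_simps)
  finally show ?case .
qed

section \<open>Degrees 3, 4, 5: excluding the remaining candidate roots\<close>

lemma moore_poly_3_no_root:
  fixes l :: complex
  assumes "l \<in> of_int ` {-2..2} \<or> l\<^sup>2 = l - 2"
  shows "poly (moore_poly 3) l \<noteq> 0"
proof
  assume "poly (moore_poly 3) l = 0"
  moreover have "moore_poly 3 = [:-2, -4, 1, 1 :: complex:]"
    by (simp add: eval_nat_numeral)
  ultimately have root: "l * l\<^sup>2 + l\<^sup>2 - 4 * l - 2 = 0"
    by (simp add: power2_eq_square algebra_simps)
  have set: "{-2..2} = {-2, -1, 0, 1, 2 :: int}" by auto
  show False using assms unfolding set
  proof (elim disjE imageE)
    assume 2: "l\<^sup>2 = l - 2"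
    \<comment> \<open>Euclid's algorithm for the quadratic and \<open>moore_poly 3\<close> ends in
      the constant 92, so they have no common root. The constants for degrees 4 and 5 arise in the
      same way.\<close>
    have "(92 :: complex) = 16 * (l\<^sup>2 - l + 2) - (4 * l - 10) * ((l + 2) * (l\<^sup>2 - l + 2) - (l * l\<^sup>2 + l\<^sup>2 - 4 * l - 2))"
      by (simp add: power2_eq_square algebra_simps)
    also have "\<dots> = 0" unfolding root using 2 by simp
    finally show False by simp
  qed (use root in auto)
qed

lemma moore_poly_4_no_root:
  fixes l :: complex
  assumes "l \<in> of_int ` {-2..2} \<or> l\<^sup>2 = l - 4"
  shows "poly (moore_poly 4) l \<noteq> 0"
proof
  assume "poly (moore_poly 4) l = 0"
  moreover have "moore_poly 4 = [:4, -4, -6, 1, 1 :: complex:]"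
    by (simp add: eval_nat_numeral)
  ultimately have root: "l\<^sup>2 * l\<^sup>2 + l * l\<^sup>2 - 6 * l\<^sup>2 - 4 * l + 4 = 0"
    by (simp add: power2_eq_square algebra_simps)
  have set: "{-2..2} = {-2, -1, 0, 1, 2 :: int}" by auto
  show False using assms unfolding set
  proof (elim disjE imageE)
    assume 2: "l\<^sup>2 = l - 4"
    have "(2176 :: complex) = 400 * (l\<^sup>2 - l + 4) - (20 * l + 16) * ((l\<^sup>2 + 2 * l - 8) * (l\<^sup>2 - l + 4) - (l\<^sup>2 * l\<^sup>2 + l * l\<^sup>2 - 6 * l\<^sup>2 - 4 * l + 4))"
      by (simp add: power2_eq_square algebra_simps)
    also have "\<dots> = 0" unfolding root using 2 by simp
    finally show False by simp
  qed (use root in auto)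
qed

lemma moore_poly_5_no_root:
  fixes l :: complex
  assumes "l \<in> of_int ` {-2..2} \<or> l\<^sup>2 = l - 6"
  shows "poly (moore_poly 5) l \<noteq> 0"
proof
  assume "poly (moore_poly 5) l = 0"
  moreover have "moore_poly 5 = [:4, 12, -6, -8, 1, 1 :: complex:]"
    by (simp add: eval_nat_numeral)
  ultimately have root: "l * (l\<^sup>2 * l\<^sup>2) + l\<^sup>2 * l\<^sup>2 - 8 * (l * l\<^sup>2) - 6 * l\<^sup>2 + 12 * l + 4 = 0"
    by (simp add: power2_eq_square algebra_simps)
  have set: "{-2..2} = {-2, -1, 0, 1, 2 :: int}" by auto
  show False using assms unfolding set
  proof (elim disjE imageE)
    assume 2: "l\<^sup>2 = l - 6"
    have "(61288 :: complex) = 2916 * (l\<^sup>2 - l + 6) - (54 * l - 238) * ((l * (l\<^sup>2 * l\<^sup>2) + l\<^sup>2 * l\<^sup>2 - 8 * (l * l\<^sup>2) - 6 * l\<^sup>2 + 12 * l + 4) - (l * l\<^sup>2 + 2 * l\<^sup>2 - 12 * l - 30) * (l\<^sup>2 - l + 6))"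
      by (simp add: power2_eq_square algebra_simps)
    also have "\<dots> = 0" unfolding root using 2 by simp
    finally show False by simp
  qed (use root in auto)
qed

section \<open>Multiplicities of the eigenvalues\<close>

text \<open>\<open>es\<close> is the list of eigenvalues, with multiplicity, of the adjacency matrix of a cubic Moore
  graph with \<open>n\<close> vertices and diameter \<open>d\<close>.\<close>

context
  fixes es :: "complex list" and d n :: nat
  assumes traces: "\<And>i. i \<le> d \<Longrightarrow> (\<Sum>e\<leftarrow>es. poly (moore_poly i) e) = of_nat n"
    and spectrum: "\<And>e. e \<in> set es \<Longrightarrow> (e - 3) * poly (moore_poly d) e = 0"
    and n_pos: "n > 0"
begin

text \<open>The sum of \<open>(e - 3) * moore_quot d l e\<close> over the spectrum is computed
  twice. Every eigenvalue is 3 or a root of \<open>moore_poly d\<close>, so only the terms with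
  \<open>e = l\<close> survive; on the other hand the traces determine the sum.\<close>

lemma multiplicity_moore_quot:
  assumes root: "poly (moore_poly d) l = 0"
  shows "of_nat (count_list es l) * (l - 3) * moore_quot d l l = 3 * of_nat n * tree_poly d l"
proof (cases d)
  case (Suc i)
  have P: "tree_poly i l = - tree_poly d l"
    using moore_poly_root_tree_poly(1)[of i l] root unfolding Suc by simp
  have "(e - 3) * moore_quot d l e = (if e = l then (l - 3) * moore_quot d l l else 0)"
    if "e \<in> set es" for e
    using spectrum[OF that] moore_quot[of e l d] root by auto
  hence "(\<Sum>e\<leftarrow>es. (e - 3) * moore_quot d l e) = (\<Sum>e\<leftarrow>es. if e = l then (l - 3) * moore_quot d l l else 0)"
    by (intro arg_cong[of _ _ sum_list] map_cong refl) auto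
  also have "\<dots> = of_nat (count_list es l) * (l - 3) * moore_quot d l l"
    by (induction es) (auto simp: algebra_simps)
  finally have 1: "(\<Sum>e\<leftarrow>es. (e - 3) * moore_quot d l e) = of_nat (count_list es l) * (l - 3) * moore_quot d l l" .
  have "(e - 3) * moore_quot d l e = poly (moore_poly d) e + (l - 3) * moore_quot d l e" for e
    using moore_quot[of e l d] root by (simp add: algebra_simps)
  hence "(\<Sum>e\<leftarrow>es. (e - 3) * moore_quot d l e) = of_nat n - (3 - l) * (\<Sum>e\<leftarrow>es. moore_quot d l e)"
    using traces[of d] by (simp only: sum_list_addf sum_list_const_mult) (simp add: algebra_simps)
  also have "\<dots> = of_nat n - of_nat n * (1 - tree_poly d l + 2 * tree_poly i l)"
    using sum_list_moore_quot[of d es "of_nat n" i l, OF traces] unfolding Suc by simp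
  finally show ?thesis unfolding 1 P by (simp add: algebra_simps)
qed (use root in simp)

text \<open>The right-hand side of \<open>multiplicity_moore_quot\<close> is nonzero, hence so are
  the multiplicity and the derivative on the left.\<close>

lemma moore_poly_root_simple:
  assumes "poly (moore_poly d) l = 0"
  shows "count_list es l \<noteq> 0" "poly (pderiv (moore_poly d)) l \<noteq> 0"
proof -
  have "tree_poly d l \<noteq> 0"
    using moore_poly_root_tree_poly(2)[of "d - 1" l] assms by (cases d) auto
  hence "of_nat (count_list es l) * (l - 3) * moore_quot d l l \<noteq> 0"
    unfolding multiplicity_moore_quot[OF assms] using n_pos by simp
  thus "count_list es l \<noteq> 0" "poly (pderiv (moore_poly d)) l \<noteq> 0"
    by (auto simp: moore_quot_diag)
qed

lemma multiplicity_equation: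
  assumes root: "poly (moore_poly d) l = 0"
  shows "of_nat (count_list es l) * (3 - l) * (of_nat (2 * d + 1) * l + of_nat (6 * d + 4)) =
           3 * of_nat n * (8 - l\<^sup>2)"
proof (cases d)
  case (Suc i)
  let ?s = "tree_poly d l" and ?m = "of_nat (count_list es l) :: complex"
  have P: "tree_poly i l = - ?s" and s: "?s \<noteq> 0"
    using moore_poly_root_tree_poly[of i l] root unfolding Suc by simp_all
  have "?s * (3 * of_nat n * (8 - l\<^sup>2)) = (8 - l\<^sup>2) * (3 * of_nat n * ?s)"
    by simp
  also have "\<dots> = ?m * (l - 3) * ((8 - l\<^sup>2) * moore_quot d l l)"
    unfolding multiplicity_moore_quot[OF root, symmetric] by simp
  also have "(8 - l\<^sup>2) * moore_quot d l l = - ?s * (of_nat (2 * d + 1) * l + of_nat (6 * d + 4))"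
    using moore_quot_diag_eq[of l i] P unfolding Suc by (simp add: algebra_simps)
  finally have "?s * (3 * of_nat n * (8 - l\<^sup>2)) =
      ?s * (?m * (3 - l) * (of_nat (2 * d + 1) * l + of_nat (6 * d + 4)))"
    by (simp add: algebra_simps)
  thus ?thesis using s by simp
qed (use root in simp)

text \<open>
  For an irrational eigenvalue, \<open>multiplicity_equation\<close> is its minimal equation up to a factor. It
  forces the trace \<open>S\<close> and the norm \<open>Q\<close> to satisfy \<open>Q = (2 * d + 4) * S - 8\<close>, and \<open>\<bar>Q\<bar> < 8\<close> because
  both conjugates are roots of \<open>moore_poly d\<close>.
\<close>

lemma moore_poly_root_cases:
  fixes l :: complex
  assumes d3: "d \<ge> 3" and root: "poly (moore_poly d) l = 0"
  shows "l \<in> of_int ` {-2..2} \<or> d \<le> 5 \<and> l\<^sup>2 - l + of_nat (2 * d) - 4 = 0"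
proof (cases "l \<in> \<rat>")
  case True
  have "algebraic_int l"
    using root lead_coeff_moore_poly[of d, where 'a = int]
    by (intro algebraic_int.intros[of "moore_poly d"])
       (auto simp: of_int_moore_poly[symmetric] coeff_map_poly)
  from rational_algebraic_int_is_int[OF this True] obtain k where k: "l = of_int k"
    by (auto elim: Ints_cases)
  have "of_int (k\<^sup>2) < (8 :: real)" using moore_poly_root_bound[OF root] by (simp add: k)
  hence "k\<^sup>2 < 8" by linarith
  hence "\<bar>k\<bar> < 3" using abs_le_square_iff[of 3 k] by auto
  hence "k \<in> {-2..2}" by auto
  thus ?thesis using k by blast
next
  case False
  define m :: int where "m = int (count_list es l)"
  \<comment> \<open>The coefficients of \<open>multiplicity_equation\<close> written as a quadratic
    in \<open>l\<close>.\<close>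
  define a b c :: int where "a = 3 * int n - m * (2 * int d + 1)" and "b = - m"
    and "c = m * (18 * int d + 12) - 24 * int n"
  have m0: "m \<noteq> 0" using moore_poly_root_simple[OF root] by (simp add: m_def)
  have quad: "of_int a * l\<^sup>2 + of_int b * l + of_int c = 0"
    using multiplicity_equation[OF root]
    by (simp add: a_def b_def c_def m_def algebra_simps power2_eq_square)
  have a0: "a \<noteq> 0"
  proof
    assume "a = 0"
    hence "l = of_int c / of_int m" using quad m0 by (simp add: b_def field_simps)
    thus False using False by simp
  qed
  obtain S Q where SQ: "b = - a * S" "c = a * Q"
    and conj: "\<And>x :: complex. x\<^sup>2 - of_int S * x + of_int Q = 0 \<Longrightarrow> poly (of_int_poly (moore_poly d)) x = 0"
    using irrational_quadratic_root_of_monic_int_poly[of "moore_poly d" l a b c]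
      lead_coeff_moore_poly root quad a0 False by (metis of_int_moore_poly)
  have "of_int a * (l\<^sup>2 - of_int S * l + of_int Q) = 0"
    using quad by (simp add: SQ algebra_simps)
  hence lSQ: "l\<^sup>2 - of_int S * l + of_int Q = 0" using a0 by simp
  define l' where "l' = of_int S - l"
  have "l'\<^sup>2 - of_int S * l' + of_int Q = 0"
    using lSQ by (simp add: l'_def power2_eq_square algebra_simps)
  from conj[OF this] have "(cmod l')\<^sup>2 < 8"
    by (intro moore_poly_root_bound[of d]) (simp add: of_int_moore_poly)
  moreover have "(cmod l)\<^sup>2 < 8" by (rule moore_poly_root_bound[OF root])
  ultimately have "(cmod l)\<^sup>2 * (cmod l')\<^sup>2 < 8 * 8"
    by (intro mult_strict_mono) auto
  moreover have "l * l' = of_int Q"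
    using lSQ by (simp add: l'_def power2_eq_square algebra_simps)
  hence "(cmod l)\<^sup>2 * (cmod l')\<^sup>2 = of_int (Q\<^sup>2)"
    by (metis norm_mult norm_of_int of_int_power power2_abs power_mult_distrib)
  ultimately have "of_int (Q\<^sup>2) < (64 :: real)" by simp
  hence "Q\<^sup>2 < 64" by linarith
  hence Q8: "\<bar>Q\<bar> < 8" using abs_le_square_iff[of 8 Q] by auto
  \<comment> \<open>This combination of the coefficients vanishes identically in \<open>m\<close>
    and \<open>n\<close>, which eliminates both.\<close>
  have "a * (Q + 8 - (2 * int d + 4) * S) = c + 8 * a + (2 * int d + 4) * b"
    by (simp add: SQ algebra_simps)
  also have "\<dots> = 0" by (simp add: a_def b_def c_def algebra_simps)
  finally have Q: "Q = (2 * int d + 4) * S - 8" using a0 by simp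
  \<comment> \<open>\<open>S <= 0\<close> would give \<open>Q <= -8\<close>, and
    \<open>S >= 2\<close> would give \<open>Q >= 12\<close>.\<close>
  have "S > 0" using Q Q8 by (smt (verit) zero_less_mult_iff of_nat_0_le_iff)
  moreover have "S < 2"
  proof (rule ccontr)
    assume "\<not> S < 2"
    hence "10 * 2 \<le> (2 * int d + 4) * S" using d3 by (intro mult_mono) auto
    thus False using Q Q8 by simp
  qed
  ultimately have "S = 1" by simp
  with Q have Q': "Q = 2 * int d - 4" by simp
  hence "d \<le> 5" using Q8 by linarith
  moreover have "l\<^sup>2 - l + of_nat (2 * d) - 4 = 0"
    using lSQ unfolding Q' \<open>S = 1\<close> by (simp add: algebra_simps)
  ultimately show ?thesis by blast
qed

lemma moore_diameter_le_2: "d \<le> 2"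
proof (rule ccontr)
  assume "\<not> d \<le> 2"
  hence d3: "d \<ge> 3" by simp
  have deg: "degree (moore_poly d :: complex poly) = d" by (rule degree_moore_poly)
  hence nz: "moore_poly d \<noteq> (0 :: complex poly)" using d3 by auto
  show False
  proof (cases "d \<le> 5")
    case False
    \<comment> \<open>All roots are simple, so there are \<open>d >= 6\<close> of them, but only
      five candidates.\<close>
    have "rsquarefree (moore_poly d :: complex poly)"
      unfolding rsquarefree_roots using moore_poly_root_simple(2) by blast
    hence card: "card {x. poly (moore_poly d) x = (0 :: complex)} = d"
      using rsquarefree_card_degree[OF nz] deg by simp
    have "{x. poly (moore_poly d) x = (0 :: complex)} \<subseteq> of_int ` {-2..2}"
      using moore_poly_root_cases[OF d3] False by blast
    from card_mono[OF _ this] have "d \<le> card (of_int ` {-2..2} :: complex set)"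
      unfolding card by simp
    also have "\<dots> \<le> 5" using card_image_le[of "{-2..2 :: int}" "of_int :: int \<Rightarrow> complex"] by simp
    finally show False using False by simp
  next
    case True
    have "\<not> constant (poly (moore_poly d :: complex poly))"
      using deg d3 by (simp add: constant_degree)
    then obtain l :: complex where l: "poly (moore_poly d) l = 0"
      using fundamental_theorem_of_algebra by blast
    from True d3 consider "d = 3" | "d = 4" | "d = 5" by linarith
    thus False
      using l moore_poly_root_cases[OF d3 l] moore_poly_3_no_root[of l]
        moore_poly_4_no_root[of l] moore_poly_5_no_root[of l]
      by cases (auto simp: algebra_simps)
  qed
qed

end

section \<open>Triangularising the adjacency matrix\<close>

lemma upper_triangular_mult:
  fixes U W :: "'a :: comm_semiring_0 mat"
  assumes U: "U \<in> carrier_mat n n" "upper_triangular U"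
    and W: "W \<in> carrier_mat n n" "upper_triangular W"
  shows "upper_triangular (U * W)"
    and "j < n \<Longrightarrow> (U * W) $$ (j, j) = U $$ (j, j) * W $$ (j, j)"
proof -
  \<comment> \<open>On or below the diagonal a term survives only if
    \<open>i <= k <= j <= i\<close>; this covers both claims at once.\<close>
  have entry: "(U * W) $$ (i, j) = (\<Sum>k\<in>{0..<n}. if k = j \<and> i = j then U $$ (j, j) * W $$ (j, j) else 0)"
    if le: "j \<le> i" "i < n" for i j
  proof -
    have "(U * W) $$ (i, j) = (\<Sum>k\<in>{0..<n}. U $$ (i, k) * W $$ (k, j))"
      using U W that by (auto simp: scalar_prod_def)
    also have "\<dots> = (\<Sum>k\<in>{0..<n}. if k = j \<and> i = j then U $$ (j, j) * W $$ (j, j) else 0)"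
    proof (rule sum.cong[OF refl])
      fix k assume k: "k \<in> {0..<n}"
      consider "k < i" | "k > j" | "k = i" "k = j" using le by linarith
      thus "U $$ (i, k) * W $$ (k, j) = (if k = j \<and> i = j then U $$ (j, j) * W $$ (j, j) else 0)"
      proof cases
        case 1
        thus ?thesis using U that upper_triangularD[OF U(2), of k i] by auto
      next
        case 2
        thus ?thesis using W k upper_triangularD[OF W(2), of j k] by auto
      qed simp
    qed
    finally show ?thesis .
  qed
  show "upper_triangular (U * W)"
    using U entry by (intro upper_triangularI) auto
  show "j < n \<Longrightarrow> (U * W) $$ (j, j) = U $$ (j, j) * W $$ (j, j)"
    using entry[of j j] by simp
qed

lemma sum_diag_mult_commute:
  fixes X Y :: "'a :: comm_semiring_0 mat"
  assumes "X \<in> carrier_mat n n" "Y \<in> carrier_mat n n"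
  shows "(\<Sum>j<n. (X * Y) $$ (j, j)) = (\<Sum>j<n. (Y * X) $$ (j, j))"
proof -
  have "(\<Sum>j<n. (X * Y) $$ (j, j)) = (\<Sum>j<n. \<Sum>k<n. X $$ (j, k) * Y $$ (k, j))"
    using assms by (intro sum.cong refl) (auto simp: scalar_prod_def atLeast0LessThan)
  also have "\<dots> = (\<Sum>k<n. \<Sum>j<n. Y $$ (k, j) * X $$ (j, k))"
    by (subst sum.swap) (simp add: mult.commute)
  also have "\<dots> = (\<Sum>j<n. (Y * X) $$ (j, j))"
    using assms by (intro sum.cong refl) (auto simp: scalar_prod_def atLeast0LessThan)
  finally show ?thesis .
qed

text \<open>Conjugation to Schur form makes every \<open>M i\<close> with \<open>i <= d\<close>
  upper triangular, with the values of \<open>moore_poly i\<close> at the eigenvalues on the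
  diagonal. The traces and \<open>A * M d = 3 * M d\<close> can be read off there.\<close>

lemma moore_matrix_diameter_le_2:
  fixes A :: "complex mat" and M :: "nat \<Rightarrow> complex mat"
  assumes A: "A \<in> carrier_mat n n" and M: "\<And>i. M i \<in> carrier_mat n n"
    and M0: "M 0 = 1\<^sub>m n" and M1: "M (Suc 0) = A + 1\<^sub>m n"
    and MSuc: "\<And>i. Suc (Suc i) \<le> d \<Longrightarrow> M (Suc (Suc i)) = A * M (Suc i) - 2 \<cdot>\<^sub>m M i"
    and trace: "\<And>i. i \<le> d \<Longrightarrow> (\<Sum>j<n. M i $$ (j, j)) = of_nat n"
    and Md: "A * M d = 3 \<cdot>\<^sub>m M d" and n: "n > 0"
  shows "d \<le> 2"
proof -
  obtain es where es: "char_poly A = (\<Prod>a\<leftarrow>es. [:- a, 1:])"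
    using char_poly_factorized[OF A] by blast
  obtain B P Q where schur: "schur_decomposition A es = (B, P, Q)" by (metis prod_cases3)
  note sd = schur_decomposition[OF A es schur]
  note wit = similar_mat_witD2[OF A sd[THEN conjunct1]]
  have B: "B \<in> carrier_mat n n" and P: "P \<in> carrier_mat n n" and Q: "Q \<in> carrier_mat n n"
    and PQ: "P * Q = 1\<^sub>m n" and QP: "Q * P = 1\<^sub>m n" and APBQ: "A = P * B * Q"
    using wit by auto
  have utB: "upper_triangular B" and diagB: "diag_mat B = es" using sd by auto
  have conj_mult: "Q * (X * Y) * P = (Q * X * P) * (Q * Y * P)"
    if X: "X \<in> carrier_mat n n" and Y: "Y \<in> carrier_mat n n" for X Y
  proof -
    have "P * (Q * Y * P) = P * (Q * (Y * P))" using P Q Y by (simp add: assoc_mult_mat[of _ n n])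
    also have "\<dots> = (P * Q) * (Y * P)"
      using P Q Y by (intro assoc_mult_mat[symmetric]) auto
    also have "\<dots> = Y * P" unfolding PQ using Y P by simp
    finally have 1: "P * (Q * Y * P) = Y * P" .
    have "(Q * X * P) * (Q * Y * P) = Q * X * (P * (Q * Y * P))"
      using P Q X Y by (intro assoc_mult_mat) auto
    also have "\<dots> = Q * X * (Y * P)" by (simp only: 1)
    also have "\<dots> = Q * (X * (Y * P))" using P Q X Y by (intro assoc_mult_mat) auto
    also have "X * (Y * P) = X * Y * P" using P X Y by (intro assoc_mult_mat[symmetric]) auto
    also have "Q * (X * Y * P) = Q * (X * Y) * P"
      using P Q X Y by (intro assoc_mult_mat[symmetric]) auto
    finally show ?thesis by simp
  qed
  have B_eq: "Q * A * P = B"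
  proof -
    have "Q * A * P = (Q * (P * B) * P) * (Q * Q * P)"
      unfolding APBQ using B P Q by (intro conj_mult) auto
    also have "Q * (P * B) = Q * P * B" using B P Q by (intro assoc_mult_mat[symmetric]) auto
    also have "\<dots> = B" unfolding QP using B by simp
    also have "Q * Q * P = Q * (Q * P)" using P Q by (intro assoc_mult_mat) auto
    also have "\<dots> = Q" unfolding QP using Q by simp
    also have "B * P * Q = B * (P * Q)" using B P Q by (intro assoc_mult_mat) auto
    also have "\<dots> = B" unfolding PQ using B by simp
    finally show ?thesis .
  qed
  define N where "N i = Q * M i * P" for i
  have N: "N i \<in> carrier_mat n n" for i using M P Q unfolding N_def by auto
  have N0: "N 0 = 1\<^sub>m n" unfolding N_def M0 using QP Q by simp
  have N1: "N (Suc 0) = B + 1\<^sub>m n"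
    unfolding N_def M1 B_eq[symmetric] using A P Q QP
    by (simp add: mult_add_distrib_mat[of _ n n] add_mult_distrib_mat[of _ n n])
  have NSuc: "N (Suc (Suc i)) = B * N (Suc i) - 2 \<cdot>\<^sub>m N i" if "Suc (Suc i) \<le> d" for i
  proof -
    have "N (Suc (Suc i)) = Q * (A * M (Suc i)) * P - Q * (2 \<cdot>\<^sub>m M i) * P"
    proof -
      have 1: "A * M (Suc i) \<in> carrier_mat n n" "2 \<cdot>\<^sub>m M i \<in> carrier_mat n n"
        using A M[of i] M[of "Suc i"] by auto
      have "Q * (A * M (Suc i) - 2 \<cdot>\<^sub>m M i) = Q * (A * M (Suc i)) - Q * (2 \<cdot>\<^sub>m M i)"
        by (rule mult_minus_distrib_mat[OF Q 1])
      also have "\<dots> * P = Q * (A * M (Suc i)) * P - Q * (2 \<cdot>\<^sub>m M i) * P"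
        using Q P 1 by (intro minus_mult_distrib_mat[of _ n n]) auto
      finally show ?thesis unfolding N_def MSuc[OF that] .
    qed
    also have "Q * (2 \<cdot>\<^sub>m M i) * P = 2 \<cdot>\<^sub>m N i"
      unfolding N_def using P Q M[of i]
      by (simp add: mult_smult_distrib[of _ n n] mult_smult_assoc_mat[of _ n n])
    also have "Q * (A * M (Suc i)) * P = B * N (Suc i)"
      unfolding N_def using conj_mult[OF A M] B_eq by simp
    finally show ?thesis .
  qed
  have Nd: "B * N d = 3 \<cdot>\<^sub>m N d"
  proof -
    have "B * N d = Q * (A * M d) * P" unfolding N_def using conj_mult[OF A M] B_eq by simp
    also have "\<dots> = 3 \<cdot>\<^sub>m N d" unfolding N_def Md using P Q M[of d]
      by (simp add: mult_smult_distrib[of _ n n] mult_smult_assoc_mat[of _ n n])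
    finally show ?thesis .
  qed
  have tri: "upper_triangular (N i) \<and> (\<forall>j<n. N i $$ (j, j) = poly (moore_poly i) (B $$ (j, j)))"
    if "i \<le> d" for i
    using that
  proof (induction i rule: moore_poly.induct)
    case 1
    show ?case unfolding N0 by auto
  next
    case 2
    show ?case unfolding N1 using B upper_triangularD[OF utB] by (auto intro!: upper_triangularI)
  next
    case (3 i)
    have IH: "upper_triangular (N i)" "upper_triangular (N (Suc i))"
      "\<And>j. j < n \<Longrightarrow> N i $$ (j, j) = poly (moore_poly i) (B $$ (j, j))"
      "\<And>j. j < n \<Longrightarrow> N (Suc i) $$ (j, j) = poly (moore_poly (Suc i)) (B $$ (j, j))"
      using 3 by auto
    note mult = upper_triangular_mult[OF B utB N IH(2)]
    have "upper_triangular (B * N (Suc i) - 2 \<cdot>\<^sub>m N i)"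
      using B N[of i] N[of "Suc i"] upper_triangularD[OF IH(1)] upper_triangularD[OF mult(1)]
      by (intro upper_triangularI) auto
    moreover have "(B * N (Suc i) - 2 \<cdot>\<^sub>m N i) $$ (j, j) = poly (moore_poly (Suc (Suc i))) (B $$ (j, j))"
      if "j < n" for j
    proof -
      have "(B * N (Suc i) - 2 \<cdot>\<^sub>m N i) $$ (j, j) = (B * N (Suc i)) $$ (j, j) - 2 * N i $$ (j, j)"
        using that B N[of i] N[of "Suc i"] by (simp del: index_mult_mat(1))
      thus ?thesis using mult(2)[OF that] IH(3,4)[OF that] by simp
    qed
    ultimately show ?case unfolding NSuc[OF 3(3)] by blast
  qed
  have es': "es = map (\<lambda>j. B $$ (j, j)) [0..<n]" using diagB B by (auto simp: diag_mat_def)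
  have sum_es: "(\<Sum>e\<leftarrow>es. f e) = (\<Sum>j<n. f (B $$ (j, j)))" for f :: "complex \<Rightarrow> complex"
    unfolding es' by (simp add: interv_sum_list_conv_sum_set_nat atLeast0LessThan o_def)
  show ?thesis
  proof (rule moore_diameter_le_2[of d es n])
    fix i assume i: "i \<le> d"
    have "(\<Sum>e\<leftarrow>es. poly (moore_poly i) e) = (\<Sum>j<n. N i $$ (j, j))"
      unfolding sum_es using tri[OF i] by simp
    also have "\<dots> = (\<Sum>j<n. (P * (Q * M i)) $$ (j, j))"
      unfolding N_def using P Q M[of i] by (intro sum_diag_mult_commute) auto
    also have "P * (Q * M i) = P * Q * M i" using P Q M[of i] by (intro assoc_mult_mat[symmetric]) auto
    also have "\<dots> = M i" unfolding PQ using M[of i] by simp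
    finally show "(\<Sum>e\<leftarrow>es. poly (moore_poly i) e) = of_nat n" using trace[OF i] by simp
  next
    fix e assume "e \<in> set es"
    then obtain j where j: "j < n" "e = B $$ (j, j)" unfolding es' by auto
    have "(B * N d) $$ (j, j) = e * poly (moore_poly d) e"
      using upper_triangular_mult(2)[OF B utB N] tri[of d] j by auto
    moreover have "(B * N d) $$ (j, j) = 3 * poly (moore_poly d) e"
      unfolding Nd using tri[of d] j N[of d] by auto
    ultimately show "(e - 3) * poly (moore_poly d) e = 0" by (simp add: algebra_simps)
  qed (rule n)
qed

section \<open>Transfer to digraphs\<close>

abbreviation adj :: "('a, 'b) pre_digraph \<Rightarrow> 'a \<Rightarrow> 'a \<Rightarrow> bool" where
  "adj G x y \<equiv> (x, y) \<in> arcs_ends G"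

section \<open>The matrices of a Moore graph\<close>

context cubic_moore_graph
begin

text \<open>\<open>M i\<close> is the indicator matrix of distance at most \<open>i\<close>, with
  ones on the diagonal. An entry of \<open>B * M i\<close> counts neighbours, so
  \<open>card_closer_nbrs\<close> yields the recurrence; \<open>M d\<close> is the all-ones matrix,
  which \<open>B\<close> multiplies by 3.\<close>

lemma diameter_le_2:
  assumes V: "V \<noteq> {}"
  shows "d \<le> 2"
proof -
  define n where "n = card V"
  have n: "n > 0" using V finite_V by (auto simp: n_def card_gt_0_iff)
  obtain f where f: "bij_betw f {..<n} V"
    using ex_bij_betw_nat_finite[OF finite_V] unfolding n_def atLeast0LessThan by blast
  have fV: "f j \<in> V" if "j < n" for j using f that by (auto simp: bij_betw_def)
  have f_eq: "f j = f k \<longleftrightarrow> j = k" if "j < n" "k < n" for j k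
    using f that by (auto simp: bij_betw_def inj_on_def)
  define B :: "complex mat" where "B = mat n n (\<lambda>(j, k). of_bool (A (f j) (f k)))"
  define M :: "nat \<Rightarrow> complex mat" where
    "M i = mat n n (\<lambda>(j, k). of_bool (reach A i (f j) (f k)))" for i
  have B: "B \<in> carrier_mat n n" and M: "M i \<in> carrier_mat n n" for i
    by (auto simp: B_def M_def)
  have BM: "(B * M i) $$ (j, k) = of_nat (card {z. A (f j) z \<and> reach A i z (f k)})"
    if "j < n" "k < n" for i j k
  proof -
    have "(B * M i) $$ (j, k) = (\<Sum>l<n. of_bool (A (f j) (f l)) * of_bool (reach A i (f l) (f k)))"
      using that by (simp add: B_def M_def scalar_prod_def atLeast0LessThan)
    also have "\<dots> = (\<Sum>z\<in>V. of_bool (A (f j) z) * of_bool (reach A i z (f k)))"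
      by (rule sum.reindex_bij_betw[OF f])
    also have "\<dots> = (\<Sum>z\<in>V. of_bool (A (f j) z \<and> reach A i z (f k)))"
      by (intro sum.cong) auto
    also have "\<dots> = of_nat (card (V \<inter> {z. A (f j) z \<and> reach A i z (f k)}))"
      using finite_V by (simp add: sum_of_bool_eq)
    also have "V \<inter> {z. A (f j) z \<and> reach A i z (f k)} = {z. A (f j) z \<and> reach A i z (f k)}"
      using adj_V' by blast
    finally show ?thesis .
  qed
  show ?thesis
  proof (rule moore_matrix_diameter_le_2[OF B M])
    show "M 0 = 1\<^sub>m n"
      by (rule eq_matI) (auto simp: M_def f_eq)
    show "M (Suc 0) = B + 1\<^sub>m n"
      by (rule eq_matI) (auto simp: M_def B_def f_eq irrefl)
    show "(\<Sum>j<n. M i $$ (j, j)) = of_nat n" for i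
      by (simp add: M_def)
    show "B * M d = 3 \<cdot>\<^sub>m M d"
    proof (rule eq_matI)
      fix j k assume jk: "j < dim_row (3 \<cdot>\<^sub>m M d)" "k < dim_col (3 \<cdot>\<^sub>m M d)"
      hence jk: "j < n" "k < n" by (auto simp: M_def)
      have "{z. A (f j) z \<and> reach A d z (f k)} = {z. A (f j) z}"
        using diameter adj_V' fV jk by blast
      thus "(B * M d) $$ (j, k) = (3 \<cdot>\<^sub>m M d) $$ (j, k)"
        using BM[OF jk] cubic fV diameter jk by (simp add: M_def)
    qed (auto simp: B_def M_def)
    show "M (Suc (Suc i)) = B * M (Suc i) - 2 \<cdot>\<^sub>m M i" if i: "Suc (Suc i) \<le> d" for i
    proof (rule eq_matI)
      fix j k assume jk: "j < dim_row (B * M (Suc i) - 2 \<cdot>\<^sub>m M i)"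
        "k < dim_col (B * M (Suc i) - 2 \<cdot>\<^sub>m M i)"
      hence jk: "j < n" "k < n" by (auto simp: M_def)
      have "(B * M (Suc i) - 2 \<cdot>\<^sub>m M i) $$ (j, k) = (B * M (Suc i)) $$ (j, k) - 2 * M i $$ (j, k)"
        using jk B M by (simp add: M_def del: index_mult_mat(1))
      also have "\<dots> = of_bool (reach A (Suc (Suc i)) (f j) (f k))"
        unfolding BM[OF jk] card_closer_nbrs[OF fV[OF jk(1)] i] using jk
        by (simp add: M_def del: reach.simps)
      also have "\<dots> = M (Suc (Suc i)) $$ (j, k)" using jk by (simp add: M_def)
      finally show "M (Suc (Suc i)) $$ (j, k) = (B * M (Suc i) - 2 \<cdot>\<^sub>m M i) $$ (j, k)" by simp
    qed (auto simp: B_def M_def)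
  qed (rule n)
qed

end

section \<open>Arc walks and vertex lists\<close>

context graph
begin

lemma simple_graph_adj: "simple_graph (adj G)"
proof
  show "adj G y x" if "adj G x y" for x y
    using sym_arcs that by (auto simp: symmetric_def dest: symD)
  show "\<not> adj G x x" for x using no_loops by (auto simp: arcs_ends_def arc_to_ends_def)
qed

lemma card_adj: "card {y. adj G x y} = out_degree G x"
proof -
  have "{y. adj G x y} = head G ` out_arcs G x"
    by (auto simp: arcs_ends_def arc_to_ends_def out_arcs_def)
  moreover have "inj_on (head G) (out_arcs G x)"
    by (auto simp: inj_on_def out_arcs_def arc_to_ends_def intro!: no_multi_arcs)
  ultimately show ?thesis by (simp add: card_image out_degree_def)
qed

lemma successively_adj_awalk:
  "successively (adj G) (u # xs) \<Longrightarrow> u \<in> verts G \<Longrightarrow>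
    \<exists>p. awalk u p (last (u # xs)) \<and> awalk_verts u p = u # xs \<and> length p = length xs"
proof (induction xs arbitrary: u)
  case Nil
  thus ?case by (intro exI[of _ "[]"]) (auto simp: awalk_Nil_iff)
next
  case (Cons x xs)
  then obtain e where e: "e \<in> arcs G" "tail G e = u" "head G e = x"
    by (auto simp: arcs_ends_def arc_to_ends_def)
  moreover from this have "x \<in> verts G" by auto
  then obtain p where "awalk x p (last (x # xs))" "awalk_verts x p = x # xs" "length p = length xs"
    using Cons by auto
  ultimately show ?case by (intro exI[of _ "e # p"]) (auto simp: awalk_Cons_iff)
qed

lemma vertex_cycle_undirected_cycle:
  assumes "vertex_cycle (adj G) xs"
  shows "\<exists>p. undirected_cycle G p \<and> length p = length xs"
proof -
  have ne: "xs \<noteq> []" using assms by (auto simp: vertex_cycle_def)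
  \<comment> \<open>Starting at \<open>last xs\<close> makes \<open>xs\<close> the tail of the
    visited vertices, the list that \<open>cycle\<close> requires to be distinct.\<close>
  have "successively (adj G) (last xs # xs)"
    using assms ne by (cases xs) (auto simp: vertex_cycle_def)
  moreover have "last xs \<in> verts G"
    using assms by (auto simp: vertex_cycle_def arcs_ends_def arc_to_ends_def)
  ultimately obtain p where p: "awalk (last xs) p (last (last xs # xs))"
    "awalk_verts (last xs) p = last xs # xs" "length p = length xs"
    using successively_adj_awalk by blast
  hence "cycle p" unfolding cycle_def using assms ne
    by (intro exI[of _ "last xs"]) (auto simp: vertex_cycle_def)
  thus ?thesis using p assms by (auto simp: undirected_cycle_def vertex_cycle_def)
qed

lemma awalk_path_edges:
  "awalk u p v \<Longrightarrow> successively (adj G) (awalk_verts u p) \<and>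
    path_edges (awalk_verts u p) = edge_of G ` set p \<and> hd (awalk_verts u p) = u
    \<and> last (awalk_verts u p) = v"
proof (induction p arbitrary: u)
  case (Cons e p)
  hence e: "e \<in> arcs G" "tail G e = u" "awalk (head G e) p v" by (auto simp: awalk_Cons_iff)
  obtain xs where xs: "awalk_verts (head G e) p = head G e # xs"
    using Cons.IH[OF e(3)] by (cases "awalk_verts (head G e) p") auto
  have "adj G u (head G e)" using e by (auto simp: arcs_ends_def arc_to_ends_def)
  thus ?case using Cons.IH[OF e(3)] e(2) xs by (auto simp: edge_of_def)
qed (auto simp: awalk_Nil_iff)

lemma undirected_cycle_vertex_cycle:
  assumes "undirected_cycle G p"
  shows "\<exists>xs. vertex_cycle (adj G) xs \<and> length xs = length p \<and> edge_of G ` set p = cycle_edges xs"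
proof -
  obtain u where u: "awalk u p u" "distinct (tl (awalk_verts u p))" and len: "3 \<le> length p"
    using assms by (auto simp: undirected_cycle_def cycle_def)
  obtain xs where xs: "awalk_verts u p = u # xs"
    using awalk_path_edges[OF u(1)] by (cases "awalk_verts u p") auto
  have "length (awalk_verts u p) = Suc (length p)" by (induction p arbitrary: u) auto
  hence l: "length xs = length p" by (simp add: xs)
  hence ne: "xs \<noteq> []" using len by auto
  have last: "last xs = u" using awalk_path_edges[OF u(1)] ne by (auto simp: xs)
  have "adj G (last xs) (hd xs)" "successively (adj G) xs"
    using awalk_path_edges[OF u(1)] ne last unfolding xs by (cases xs; auto)+
  hence "vertex_cycle (adj G) xs"
    using u(2) len l by (auto simp: vertex_cycle_def xs)
  moreover have "edge_of G ` set p = cycle_edges xs"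
    using awalk_path_edges[OF u(1)] by (simp add: xs last cycle_edges_def)
  ultimately show ?thesis using l by blast
qed

lemma vertex_cycle_girth_le:
  "vertex_cycle (adj G) xs \<Longrightarrow> girth G \<le> enat (length xs)"
  using vertex_cycle_undirected_cycle[of xs] unfolding girth_def by (metis INF_lower mem_Collect_eq)

lemma girth_cycles_vertex_cycle:
  assumes "C \<in> girth_cycles G"
  obtains xs where "vertex_cycle (adj G) xs" "enat (length xs) = girth G" "C = cycle_edges xs"
  using assms undirected_cycle_vertex_cycle unfolding girth_cycles_def by force

text \<open>An isomorphism must map arcs as well: each arc goes to the pair of images of its ends,
  injectively because there are no parallel arcs.\<close>

lemma digraph_iso_with_projI:
  assumes f: "inj_on f (verts G)" "f ` verts G = pverts H"
    and H: "parcs H \<subseteq> pverts H \<times> pverts H"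
    and arcs: "\<And>x y. x \<in> verts G \<Longrightarrow> y \<in> verts G \<Longrightarrow> adj G x y \<longleftrightarrow> (f x, f y) \<in> parcs H"
  shows "digraph_iso G (with_proj H)"
proof -
  define h where "h = \<lparr> iso_verts = f, iso_arcs = (\<lambda>a. (f (tail G a), f (head G a))),
    iso_head = snd, iso_tail = fst \<rparr>"
  have "inj_on (\<lambda>a. (f (tail G a), f (head G a))) (arcs G)"
    using f(1) by (auto simp: inj_on_def arc_to_ends_def intro!: no_multi_arcs)
  hence "digraph_isomorphism h"
    using f(1) by (auto simp: digraph_isomorphism_def h_def wf_digraph)
  moreover have "(\<lambda>a. (f (tail G a), f (head G a))) ` arcs G = parcs H"
  proof (intro equalityI subsetI)
    fix e assume "e \<in> (\<lambda>a. (f (tail G a), f (head G a))) ` arcs G"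
    then obtain a where a: "a \<in> arcs G" "e = (f (tail G a), f (head G a))" by blast
    have "adj G (tail G a) (head G a)" using a by (auto simp: arcs_ends_def arc_to_ends_def)
    thus "e \<in> parcs H" using arcs a by auto
  next
    fix e assume e: "e \<in> parcs H"
    hence "e \<in> f ` verts G \<times> f ` verts G" using H unfolding f(2) by blast
    then obtain x y where xy: "x \<in> verts G" "y \<in> verts G" "e = (f x, f y)" by auto
    then obtain a where "a \<in> arcs G" "tail G a = x" "head G a = y"
      using arcs[of x y] e by (auto simp: arcs_ends_def arc_to_ends_def)
    thus "e \<in> (\<lambda>a. (f (tail G a), f (head G a))) ` arcs G" using xy by auto
  qed
  hence "with_proj H = app_iso h G"
    using f(2) by (simp add: app_iso_def with_proj_def h_def)
  ultimately show ?thesis unfolding digraph_iso_def by blast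
qed

end

section \<open>The two isomorphisms and the theorem\<close>

lemma digraph_iso_petersen:
  assumes "graph G" and "cubic_moore_graph_2 (adj G) (verts G) d" and "verts G \<noteq> {}"
  shows "digraph_iso G (with_proj petersen_graph)"
proof -
  interpret graph G by fact
  interpret cubic_moore_graph_2 "adj G" "verts G" d by fact
  obtain u v a a' b b' p q r s where
    V: "verts G = {u, v, a, a', b, b', p, q, r, s}" and dist: "distinct [u, v, a, a', b, b', p, q, r, s]" and
    N: "\<forall>t. adj G u t \<longleftrightarrow> t = v \<or> t = a \<or> t = a'" "\<forall>t. adj G v t \<longleftrightarrow> t = u \<or> t = b \<or> t = b'"
    "\<forall>t. adj G a t \<longleftrightarrow> t = u \<or> t = p \<or> t = q" "\<forall>t. adj G a' t \<longleftrightarrow> t = u \<or> t = r \<or> t = s"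
    "\<forall>t. adj G b t \<longleftrightarrow> t = v \<or> t = p \<or> t = r" "\<forall>t. adj G b' t \<longleftrightarrow> t = v \<or> t = q \<or> t = s"
    "\<forall>t. adj G p t \<longleftrightarrow> t = a \<or> t = b \<or> t = s" "\<forall>t. adj G q t \<longleftrightarrow> t = a \<or> t = b' \<or> t = r"
    "\<forall>t. adj G r t \<longleftrightarrow> t = a' \<or> t = b \<or> t = q" "\<forall>t. adj G s t \<longleftrightarrow> t = a' \<or> t = b' \<or> t = p"
    by (rule petersen_structure[OF assms(3)])
  \<comment> \<open>Adjacent vertices get disjoint pairs: \<open>u\<close> and \<open>v\<close> are
    chosen first, their other neighbours get the remaining pairs disjoint from them, and each of
    \<open>p\<close>, \<open>q\<close>, \<open>r\<close>, \<open>s\<close> gets the complement of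
    the union of its two neighbours among the latter.\<close>
  define f where "f = (\<lambda>_. {})(u := {0, 1}, v := {2, 3}, a := {2, 4}, a' := {3, 4}, b := {0, 4},
    b' := {1, 4}, p := {1, 3}, q := {0, 3}, r := {1, 2}, s := {0, 2 :: nat})"
  have f: "f u = {0, 1}" "f v = {2, 3}" "f a = {2, 4}" "f a' = {3, 4}" "f b = {0, 4}"
    "f b' = {1, 4}" "f p = {1, 3}" "f q = {0, 3}" "f r = {1, 2}" "f s = {0, 2}"
    using dist by (auto simp: f_def)
  define W :: "nat set set" where "W = {A. A \<subseteq> {0..<5} \<and> card A = 2}"
  have fW: "f x \<in> W" if "x \<in> verts G" for x
    using that unfolding V W_def by (auto simp: f)
  have inj: "inj_on f (verts G)"
    unfolding V using dist by (simp add: insert_Diff_if f doubleton_eq_iff)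
  have "card W = 10"
    unfolding W_def by (subst n_subsets) (auto simp: choose_two)
  moreover have "card (verts G) = 10" unfolding V using dist by simp
  moreover have "finite W" unfolding W_def by simp
  ultimately have image: "f ` verts G = W"
    using fW inj by (intro card_subset_eq) (auto simp: card_image)
  have "\<forall>y\<in>verts G. adj G x y \<longleftrightarrow> f x \<inter> f y = {}" if "x \<in> verts G" for x
  proof -
    note ne = dist[simplified]
    have "x = u \<or> x = v \<or> x = a \<or> x = a' \<or> x = b \<or> x = b' \<or> x = p \<or> x = q \<or> x = r \<or> x = s"
      using that unfolding V by simp
    thus ?thesis unfolding V
      by (elim disjE; simp add: N f; use ne in auto)
  qed
  hence adj: "adj G x y \<longleftrightarrow> f x \<inter> f y = {}" if "x \<in> verts G" "y \<in> verts G" for x y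
    using that by blast
  show ?thesis
  proof (rule digraph_iso_with_projI[of f])
    show "f ` verts G = pverts petersen_graph"
      by (simp add: image petersen_graph_def W_def)
    show "adj G x y \<longleftrightarrow> (f x, f y) \<in> parcs petersen_graph" if "x \<in> verts G" "y \<in> verts G" for x y
      using adj[OF that] fW[OF that(1)] fW[OF that(2)] by (simp add: petersen_graph_def W_def)
  qed (use inj in \<open>auto simp: petersen_graph_def\<close>)
qed

lemma digraph_iso_complete:
  assumes "graph G" and "\<And>x y. x \<in> verts G \<Longrightarrow> y \<in> verts G \<Longrightarrow> x \<noteq> y \<Longrightarrow> adj G x y"
  shows "digraph_iso G (with_proj (complete_graph (card (verts G))))"
proof -
  interpret graph G by fact
  interpret simple_graph "adj G" by (rule simple_graph_adj)
  obtain f where f: "bij_betw f (verts G) {0..<card (verts G)}"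
    using ex_bij_betw_finite_nat[OF finite_verts] by blast
  show ?thesis
  proof (rule digraph_iso_with_projI[of f])
    show "adj G x y \<longleftrightarrow> (f x, f y) \<in> parcs (complete_graph (card (verts G)))"
      if "x \<in> verts G" "y \<in> verts G" for x y
    proof -
      have "f x < card (verts G)" "f y < card (verts G)" "f x = f y \<longleftrightarrow> x = y"
        using f that by (auto simp: bij_betw_def inj_on_def)
      thus ?thesis using assms(2)[OF that] irrefl by (auto simp: complete_graph_def)
    qed
  qed (use f in \<open>auto simp: bij_betw_def complete_graph_def\<close>)
qed

theorem theorem1p4:
  fixes G :: "('a,'b) pre_digraph" and d a1 a2 a3 :: nat
  assumes "graph G"
    and "Digraph_Component.connected G"
    and "\<forall>v \<in> verts G. out_degree G v = 3"
    and "girth_regular G"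
    and "girth G = enat (2 * d + 1)"
    and "has_signature G [a1, a2, a3]"
    and "a3 = 2 ^ d"
  shows "digraph_iso G (with_proj (complete_graph 4)) \<or> digraph_iso G (with_proj petersen_graph)"
proof -
  interpret graph G by fact
  interpret simple_graph "adj G" by (rule simple_graph_adj)
  \<comment> \<open>An undirected cycle has length at least 3, which excludes girth 1.\<close>
  have d: "0 < d"
  proof -
    have "enat 3 \<le> girth G"
      unfolding girth_def by (rule INF_greatest) (auto simp: undirected_cycle_def)
    thus ?thesis using assms(5) by (cases d) auto
  qed
  interpret cubic_graph "adj G" "verts G" d
  proof
    show "x \<in> verts G" if "adj G x y" for x y
      using that by (auto simp: arcs_ends_def arc_to_ends_def)
    show "card {y. adj G x y} = 3" if "x \<in> verts G" for x
      using assms(3) that by (simp add: card_adj)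
    show "2 * d + 1 \<le> length xs" if "vertex_cycle (adj G) xs" for xs
      using vertex_cycle_girth_le[OF that] assms(5) by simp
  qed (use d in auto)
  have full: "\<exists>y. full x y" if x: "x \<in> verts G" for x
  proof -
    have "set (vertex_signature G x) = girth_cycle_count G ` incident_edges G x"
      using finite_arcs by (simp add: vertex_signature_def incident_edges_def)
    moreover have "vertex_signature G x = [a1, a2, a3]"
      using assms(6) x by (simp add: has_signature_def)
    \<comment> \<open>\<open>a3\<close> occurs in the signature of every vertex, so each vertex has
      an edge on \<open>2 ^ d\<close> girth cycles.\<close>
    ultimately have "a3 \<in> girth_cycle_count G ` incident_edges G x" by (metis list.set_intros)
    then obtain e where e: "e \<in> incident_edges G x" "girth_cycle_count G e = 2 ^ d"
      using assms(7) by auto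
    then obtain c where c: "c \<in> arcs G" "e = {tail G c, head G c}" "x \<in> e"
      by (auto simp: incident_edges_def edge_of_def)
    have "adj G (tail G c) (head G c)" using c(1) by (auto simp: arcs_ends_def arc_to_ends_def)
    with c sym[OF this] obtain y where y: "adj G x y" "e = {x, y}" by auto
    have "full x y"
    proof (rule full_if_max_cycles[OF y(1)])
      show "card {C \<in> girth_cycles G. e \<in> C} = 2 ^ d"
        using e(2) by (simp add: girth_cycle_count_def)
      fix C assume C: "C \<in> {C \<in> girth_cycles G. e \<in> C}"
      then obtain xs where "vertex_cycle (adj G) xs" "enat (length xs) = girth G" "C = cycle_edges xs"
        using girth_cycles_vertex_cycle[of C] by auto
      thus "\<exists>xs. vertex_cycle (adj G) xs \<and> length xs = 2 * d + 1 \<and> {x, y} \<in> C \<and> C = cycle_edges xs"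
        using C y(2) assms(5) by auto
    qed
    thus ?thesis by blast
  qed
  have ne: "verts G \<noteq> {}"
    using assms(2) by (auto simp: connected_def strongly_connected_def)
  interpret cubic_moore_graph "adj G" "verts G" d
  proof
    fix x y assume xy: "x \<in> verts G" "y \<in> verts G"
    \<comment> \<open>\<open>connected\<close> refers to the symmetric closure, in which
      reachability is the same as in the symmetric digraph \<open>G\<close>.\<close>
    have "x \<rightarrow>\<^sup>*\<^bsub>G\<^esub> y"
      using assms(2) xy reachable_mk_symmetric_eq[OF sym_arcs]
      by (auto simp: connected_def strongly_connected_def)
    hence "\<exists>i. reach (adj G) i x y"
    proof (induction rule: reachable_induct)
      case base
      show ?case by (intro exI[of _ 0]) simp
    next
      case (step y z)
      then obtain i where "reach (adj G) i x y" by blast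
      from reach_step'[OF this step(2)] show ?case by (rule exI)
    qed
    then obtain i where "reach (adj G) i x y" by blast
    from full_imp_diameter[OF full xy(1) this] show "reach (adj G) d x y" .
  qed
  from diameter_le_2[OF ne] d consider "d = 1" | "d = 2" by linarith
  thus ?thesis
  proof cases
    case 1
    thus ?thesis
      using digraph_iso_complete[OF assms(1)] complete_if_d_1 card_V_if_d_1 ne by fastforce
  next
    case 2
    interpret cubic_moore_graph_2 "adj G" "verts G" d by unfold_locales (rule 2)
    show ?thesis using digraph_iso_petersen[OF assms(1) cubic_moore_graph_2_axioms ne] by blast
  qed
qed

end
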